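(* Let $\mu\ge 0$, $\sigma>0$, $x>0$, and let $\{W_n,n\ge 0\}$ be the Lindley process started at $W_0=x$ with Laplace increments with location $\mu$ and scale $\sigma$. For $n\ge 1$ put $m_n^i=\min(n,i)$ and $$I_n^0=\{0\},\quad I_n^i=((i-1)\mu,i\mu]\ (1\le i\le n-1),\quad I_n^n=((n-1)\mu,n\mu+x],\quad I_n^{n+1}=(n\mu+x,+\infty),$$ so that $\bigcup_{i=0}^{n+1}I_n^i=[0,+\infty)$. Then $f_0(u)=\delta(u-x)$ and, for all $n\ge1$ and $u\ge 0$, the probability density function of $W_n$ is $$f_n(u)=\sum_{i=0}^{n+1}f_n^i(u),\qquad f_n^0(u)=c_n\delta(u),$$ $$f_n^i(u)=\Big\{\sum_{j=0}^{m_n^i-1}\frac1{(2\sigma)^n}\big[a_n^{(i,j)}(u-n\mu)^je^{u/\sigma}+b_n^{(i,j)}(u-n\mu)^je^{-u/\sigma}\big]\Big\}\mathbf 1_{I_n^i}(u),\qquad 1\le i\le n+1,$$ where the coefficients verify the following recursive relations, for $n\ge1$, $1\le i\le n+2$, $1\le j\le m_{n+1}^i-1$: $$a_{n+1}^{(i,j)}=e^{-\mu/\sigma}\sum_{k=j-1}^{m_n^{i-1}-1}(-1)^{k+j}a_n^{(i-1,k)}\frac{k!}{j!}\Big(\frac\sigma2\Big)^{k-j+1},\qquad b_{n+1}^{(i,j)}=e^{\mu/\sigma}\sum_{k=j-1}^{m_n^{i-1}-1}b_n^{(i-1,k)}\frac{k!}{j!}\Big(\frac\sigma2\Big)^{k-j+1},$$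 $$a_{n+1}^{(i,0)}=e^{-\mu/\sigma}\Big[\sum_{j=i}^{n+1}A_j^{(2)}+\sum_{k=0}^{m_n^{i-1}-1}\Big\{a_n^{(i-1,k)}\Big(\frac{((i-1-n)\mu)^{k+1}}{k+1}+(-1)^kk!\Big(\frac\sigma2\Big)^{k+1}\Big)-b_n^{(i-1,k)}\frac{e^{-2n\mu/\sigma}\sigma^{k+1}}{2^{k+1}}\Gamma\Big(1+k,\frac{2(i-1-n)\mu}\sigma\Big)\Big\}+c_n\delta_{i,1}\Big],$$ $$b_{n+1}^{(i,0)}=e^{\mu/\sigma}\Big[\sum_{j=1}^{i-2}A_j^{(1)}-\sum_{k=0}^{m_n^{i-1}-1}\Big\{b_n^{(i-1,k)}\Big(\frac{((i-2-n)\mu)^{k+1}}{k+1}-k!\Big(\frac\sigma2\Big)^{k+1}\Big)+a_n^{(i-1,k)}\frac{e^{2n\mu/\sigma}\sigma^{k+1}(-1)^k}{2^{k+1}}\Gamma\Big(1+k,\frac{-2(i-1-n)\mu}\sigma\Big)\Big\}+c_n(1-\delta_{i,1})\Big],$$ $$c_{n+1}=\frac{e^{-\mu/\sigma}}{2(2\sigma)^n}\Big\{\sum_{j=1}^{n+1}\sum_{k=0}^{m_n^j-1}\Big[a_n^{(j,k)}\frac{(y-n\mu)^{k+1}}{k+1}\Big|_{I_n^j}-b_n^{(j,k)}\frac{e^{-2n\mu/\sigma}\sigma^{k+1}}{2^{k+1}}\Gamma\Big(1+k,\frac{2(y-n\mu)}\sigma\Big)\Big|_{I_n^j}\Big]+(2\sigma)^nc_n\Big\},$$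 where $\delta_{i,j}$ is the Kronecker delta and $$A_j^{(1)}=\sum_{k=0}^{m_n^j-1}\Big\{a_n^{(j,k)}\frac{e^{2n\mu/\sigma}\sigma^{k+1}(-1)^k}{2^{k+1}}\Gamma\Big(1+k,\frac{-2(y-n\mu)}\sigma\Big)\Big|_{I_n^j}+b_n^{(j,k)}\frac{(y-n\mu)^{k+1}}{k+1}\Big|_{I_n^j}\Big\},$$ $$A_j^{(2)}=\sum_{k=0}^{m_n^j-1}\Big\{a_n^{(j,k)}\frac{(y-n\mu)^{k+1}}{k+1}\Big|_{I_n^j}-b_n^{(j,k)}\frac{e^{-2n\mu/\sigma}\sigma^{k+1}}{2^{k+1}}\Gamma\Big(1+k,\frac{2(y-n\mu)}\sigma\Big)\Big|_{I_n^j}\Big\}.$$ The initial values for the recursion are $$c_1=\tfrac12e^{-(\mu+x)/\sigma},\quad a_1^{(1,0)}=e^{-(\mu+x)/\sigma},\quad b_1^{(1,0)}=a_1^{(2,0)}=0,\quad b_1^{(2,0)}=e^{(\mu+x)/\sigma}.$$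
   Context: Lindley process with Laplace increments: $Z_1,Z_2,\dots$ are i.i.d. real random variables with density $f_Z(z)=\frac{1}{2\sigma}e^{-|z-\mu|/\sigma}$, and $W_0=x$, $W_n=\max(0,W_{n-1}+Z_n)$ for $n\ge1$. $f_n(u)=f_n(u|x)$ denotes the probability density of $W_n$ given $W_0=x$, i.e. the distributional derivative in $u$ of $\mathbb P(W_n\le u\mid W_0=x)$; $W_n$ is a mixed random variable, with an atom $c_n\delta(u)$ at $0$ plus an ordinary density on $(0,\infty)$. $\delta$ is the Dirac delta at $0$, with the convention that its full mass is counted on $[0,\infty)$. $\Gamma(m,y)=\int_y^\infty t^{m-1}e^{-t}\,dt$ is the incomplete Gamma function ($m\ge1$ integer, $y$ real, $\Gamma(m,+\infty)=0$). For an interval $I$ with endpoints $p\le q$ and a function $\phi$, $\phi(y)|_I=\phi(q)-\phi(p)$. Empty sums (upper index smaller than lower index) are $0$. The coefficients $a_n^{(n+1,k)}$ are observed to vanish for each admissible $k$, so the terms of $c_{n+1}$ and $A_{n+1}^{(2)}$ in which they multiply a power evaluated at the endpoint $+\infty$ are read as $0$.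
   Formalization: Printed recursion fails at n=2. In a_{n+1}^{(i,0)}, b_{n+1}^{(i,0)} the atom term is (2σ)^n c_n, not c_n; a's boundary terms use (right end of I_n^{i-1})−nμ for (i−1−n)μ; b's power and Γ use (left end of I_n^{i-1})−nμ for (i−2−n)μ and (i−1−n)μ. *)

theory Defs
  imports "HOL-Probability.Probability"
begin

definition laplace_density :: "real \<Rightarrow> real \<Rightarrow> real \<Rightarrow> real" where
  "laplace_density \<mu> \<sigma> z = exp (- \<bar>z - \<mu>\<bar> / \<sigma>) / (2 * \<sigma>)"

(* The increments are Z 1, Z 2, ...; Z 0 is not used. *)
primrec lindley :: "real \<Rightarrow> (nat \<Rightarrow> 'a \<Rightarrow> real) \<Rightarrow> nat \<Rightarrow> 'a \<Rightarrow> real" where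
  "lindley x Z 0 = (\<lambda>\<omega>. x)"
| "lindley x Z (Suc n) = (\<lambda>\<omega>. max 0 (lindley x Z n \<omega> + Z (Suc n) \<omega>))"


(* Generalized functions on the real line, given by their action on test functions
   (infinitely differentiable functions with compact support). *)

definition test_function :: "(real \<Rightarrow> real) \<Rightarrow> bool" where
  "test_function \<phi> \<longleftrightarrow>
     (\<forall>k y. (deriv ^^ k) \<phi> field_differentiable at y) \<and> compact (closure {y. \<phi> y \<noteq> 0})"

definition dirac :: "real \<Rightarrow> (real \<Rightarrow> real) \<Rightarrow> real" where
  "dirac y \<phi> = \<phi> y"

definition regular_gf :: "(real \<Rightarrow> real) \<Rightarrow> (real \<Rightarrow> real) \<Rightarrow> real" where
  "regular_gf g \<phi> = (LBINT u. g u * \<phi> u)"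

definition is_distributional_deriv :: "(real \<Rightarrow> real) \<Rightarrow> ((real \<Rightarrow> real) \<Rightarrow> real) \<Rightarrow> bool" where
  "is_distributional_deriv F T \<longleftrightarrow>
     (\<forall>\<phi>. test_function \<phi> \<longrightarrow> T \<phi> = - (LBINT u. F u * deriv \<phi> u))"

(* The density of a possibly mixed random variable is the distributional derivative
   of its distribution function. *)
definition has_gf_density ::
    "'a measure \<Rightarrow> ('a \<Rightarrow> real) \<Rightarrow> ((real \<Rightarrow> real) \<Rightarrow> real) \<Rightarrow> bool" where
  "has_gf_density M X T \<longleftrightarrow>
     X \<in> borel_measurable M \<and>
     is_distributional_deriv (\<lambda>u. measure M {\<omega> \<in> space M. X \<omega> \<le> u}) T"


(* Left and right endpoints of the interval I_n^i, for 1 \<le> i \<le> n + 1. *)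

definition lend :: "real \<Rightarrow> real \<Rightarrow> nat \<Rightarrow> nat \<Rightarrow> ereal" where
  "lend \<mu> x n i = (if i \<le> n then ereal ((real i - 1) * \<mu>) else ereal (real n * \<mu> + x))"

definition rend :: "real \<Rightarrow> real \<Rightarrow> nat \<Rightarrow> nat \<Rightarrow> ereal" where
  "rend \<mu> x n i =
     (if i < n then ereal (real i * \<mu>) else if i = n then ereal (real n * \<mu> + x) else \<infinity>)"

definition I_set :: "real \<Rightarrow> real \<Rightarrow> nat \<Rightarrow> nat \<Rightarrow> real set" where
  "I_set \<mu> x n i = (if i = 0 then {0} else {u. lend \<mu> x n i < ereal u \<and> ereal u \<le> rend \<mu> x n i})"

definition over_I :: "real \<Rightarrow> real \<Rightarrow> nat \<Rightarrow> nat \<Rightarrow> (ereal \<Rightarrow> real) \<Rightarrow> real" where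
  "over_I \<mu> x n i \<phi> = \<phi> (rend \<mu> x n i) - \<phi> (lend \<mu> x n i)"


(* Incomplete Gamma function; the value at \<infinity> is 0. *)
definition inc_Gamma :: "nat \<Rightarrow> ereal \<Rightarrow> real" where
  "inc_Gamma m y = (LBINT t=y..\<infinity>. t ^ (m - 1) * exp (- t))"

(* In y, these are antiderivatives of (y - n \<mu>)^k, of - (y - n \<mu>)^k exp (-2 y / \<sigma>) and of
   (y - n \<mu>)^k exp (2 y / \<sigma>), respectively.
   The power multiplies only a vanishing coefficient when y = \<infinity>, and is then read as 0. *)

definition pow_term :: "real \<Rightarrow> nat \<Rightarrow> nat \<Rightarrow> ereal \<Rightarrow> real" where
  "pow_term \<mu> n k y =
     (if y = \<infinity> then 0 else (real_of_ereal y - real n * \<mu>) ^ (k + 1) / real (k + 1))"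

definition gam_minus :: "real \<Rightarrow> real \<Rightarrow> nat \<Rightarrow> nat \<Rightarrow> ereal \<Rightarrow> real" where
  "gam_minus \<mu> \<sigma> n k y =
     exp (- 2 * real n * \<mu> / \<sigma>) * \<sigma> ^ (k + 1) / 2 ^ (k + 1) *
     inc_Gamma (1 + k) (ereal (2 / \<sigma>) * (y - ereal (real n * \<mu>)))"

definition gam_plus :: "real \<Rightarrow> real \<Rightarrow> nat \<Rightarrow> nat \<Rightarrow> ereal \<Rightarrow> real" where
  "gam_plus \<mu> \<sigma> n k y =
     exp (2 * real n * \<mu> / \<sigma>) * \<sigma> ^ (k + 1) * (- 1) ^ k / 2 ^ (k + 1) *
     inc_Gamma (1 + k) (ereal (- 2 / \<sigma>) * (y - ereal (real n * \<mu>)))"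

(* In A1 and A2, a and b are the coefficients a_n and b_n at the fixed level n. *)

definition A1 :: "real \<Rightarrow> real \<Rightarrow> real \<Rightarrow> nat \<Rightarrow> (nat \<Rightarrow> nat \<Rightarrow> real) \<Rightarrow> (nat \<Rightarrow> nat \<Rightarrow> real)
    \<Rightarrow> nat \<Rightarrow> real" where
  "A1 \<mu> \<sigma> x n a b j =
     (\<Sum>k<min n j. a j k * over_I \<mu> x n j (gam_plus \<mu> \<sigma> n k)
                 + b j k * over_I \<mu> x n j (pow_term \<mu> n k))"

definition A2 :: "real \<Rightarrow> real \<Rightarrow> real \<Rightarrow> nat \<Rightarrow> (nat \<Rightarrow> nat \<Rightarrow> real) \<Rightarrow> (nat \<Rightarrow> nat \<Rightarrow> real)
    \<Rightarrow> nat \<Rightarrow> real" where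
  "A2 \<mu> \<sigma> x n a b j =
     (\<Sum>k<min n j. a j k * over_I \<mu> x n j (pow_term \<mu> n k)
                 - b j k * over_I \<mu> x n j (gam_minus \<mu> \<sigma> n k))"

(* a n i j, b n i j and c n are the coefficients a_n^(i,j), b_n^(i,j) and c_n.

   In the source, the boundary terms of a_{n+1}^(i,0) are written with (i - 1 - n) \<mu> and those
   of b_{n+1}^(i,0) with (i - 2 - n) \<mu> in the power and (i - 1 - n) \<mu> in the Gamma function.
   These come from integrating the (i - 1)-st piece of f_n from u - \<mu> to the right endpoint of
   I_n^(i-1), respectively from its left endpoint to u - \<mu>. They are therefore stated here at
   these endpoints: rend - n \<mu>, which is (i - 1 - n) \<mu> for i \<le> n, x for i = n + 1 and \<infinity>
   for i = n + 2; and lend - n \<mu>, which is (i - 2 - n) \<mu> for i \<le> n + 1 and x for i = n + 2.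
   The atom enters as (2 \<sigma>)^n c_n because the pieces carry the factor 1 / (2 \<sigma>)^n; the source
   has this factor in c_{n+1} but not in a_{n+1}^(i,0) and b_{n+1}^(i,0).
   With the terms as printed in the source the formula for f_2 is false.

   For i = 1 the sums over k are empty (min n (i - 1) = 0), and so is {1..i - 2}. *)
definition lindley_coeffs :: "real \<Rightarrow> real \<Rightarrow> real \<Rightarrow> (nat \<Rightarrow> nat \<Rightarrow> nat \<Rightarrow> real)
    \<Rightarrow> (nat \<Rightarrow> nat \<Rightarrow> nat \<Rightarrow> real) \<Rightarrow> (nat \<Rightarrow> real) \<Rightarrow> bool" where
  "lindley_coeffs \<mu> \<sigma> x a b c \<longleftrightarrow>
     c 1 = exp (- (\<mu> + x) / \<sigma>) / 2 \<and>
     a 1 1 0 = exp (- (\<mu> + x) / \<sigma>) \<and> b 1 1 0 = 0 \<and>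
     a 1 2 0 = 0 \<and> b 1 2 0 = exp ((\<mu> + x) / \<sigma>) \<and>
     (\<forall>n\<ge>1.
       (\<forall>i\<in>{1..n + 2}.
         (\<forall>j\<in>{1..<min (n + 1) i}.
           a (n + 1) i j = exp (- \<mu> / \<sigma>) *
             (\<Sum>k = j - 1..<min n (i - 1).
                (- 1) ^ (k + j) * a n (i - 1) k * (fact k / fact j) * (\<sigma> / 2) ^ (k + 1 - j)) \<and>
           b (n + 1) i j = exp (\<mu> / \<sigma>) *
             (\<Sum>k = j - 1..<min n (i - 1).
                b n (i - 1) k * (fact k / fact j) * (\<sigma> / 2) ^ (k + 1 - j))) \<and>
         a (n + 1) i 0 = exp (- \<mu> / \<sigma>) *
           ((\<Sum>j = i..n + 1. A2 \<mu> \<sigma> x n (a n) (b n) j)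
            + (\<Sum>k<min n (i - 1).
                 a n (i - 1) k *
                   (pow_term \<mu> n k (rend \<mu> x n (i - 1)) + (- 1) ^ k * fact k * (\<sigma> / 2) ^ (k + 1))
                 - b n (i - 1) k * gam_minus \<mu> \<sigma> n k (rend \<mu> x n (i - 1)))
            + (2 * \<sigma>) ^ n * c n * (if i = 1 then 1 else 0)) \<and>
         b (n + 1) i 0 = exp (\<mu> / \<sigma>) *
           ((\<Sum>j = 1..i - 2. A1 \<mu> \<sigma> x n (a n) (b n) j)
            - (\<Sum>k<min n (i - 1).
                 b n (i - 1) k *
                   (pow_term \<mu> n k (lend \<mu> x n (i - 1)) - fact k * (\<sigma> / 2) ^ (k + 1))
                 + a n (i - 1) k * gam_plus \<mu> \<sigma> n k (lend \<mu> x n (i - 1)))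
            + (2 * \<sigma>) ^ n * c n * (1 - (if i = 1 then 1 else 0)))) \<and>
       c (n + 1) = exp (- \<mu> / \<sigma>) / (2 * (2 * \<sigma>) ^ n) *
         ((\<Sum>j = 1..n + 1. A2 \<mu> \<sigma> x n (a n) (b n) j) + (2 * \<sigma>) ^ n * c n))"

definition f_piece :: "real \<Rightarrow> real \<Rightarrow> real \<Rightarrow> (nat \<Rightarrow> nat \<Rightarrow> nat \<Rightarrow> real)
    \<Rightarrow> (nat \<Rightarrow> nat \<Rightarrow> nat \<Rightarrow> real) \<Rightarrow> nat \<Rightarrow> nat \<Rightarrow> real \<Rightarrow> real" where
  "f_piece \<mu> \<sigma> x a b n i u =
     (\<Sum>j<min n i. 1 / (2 * \<sigma>) ^ n *
        (a n i j * (u - real n * \<mu>) ^ j * exp (u / \<sigma>)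
         + b n i j * (u - real n * \<mu>) ^ j * exp (- u / \<sigma>))) * indicator (I_set \<mu> x n i) u"

(* The generalized function f_n^0 + f_n^1 + ... + f_n^(n+1), where f_n^0 is c_n times the Dirac
   delta at 0. Its whole mass is counted: it acts on \<phi> as c_n * \<phi> 0. *)
definition f_gf :: "real \<Rightarrow> real \<Rightarrow> real \<Rightarrow> (nat \<Rightarrow> nat \<Rightarrow> nat \<Rightarrow> real)
    \<Rightarrow> (nat \<Rightarrow> nat \<Rightarrow> nat \<Rightarrow> real) \<Rightarrow> (nat \<Rightarrow> real) \<Rightarrow> nat \<Rightarrow> (real \<Rightarrow> real) \<Rightarrow> real" where
  "f_gf \<mu> \<sigma> x a b c n \<phi> =
     (\<Sum>i = 0..n + 1.
        if i = 0 then c n * dirac 0 \<phi> else regular_gf (f_piece \<mu> \<sigma> x a b n i) \<phi>)"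

end

theory Submission
  imports Defs
begin

text \<open>
  A test function at $w$ is minus the integral of its derivative over $[w, \infty)$, so by Fubini
  the distributional derivative of a distribution function acts on $\phi$ as the expectation of
  $\phi(X)$ (\<open>distributional_deriv_of_cdf\<close>). The claim on the density of $W_n$ thus amounts to
  $E \phi(W_n) = c_n \phi(0) + \int g_n \phi$, where $g_n$ is the sum of the pieces
  (\<open>expectation_lindley\<close>). It is proved for all bounded measurable $\phi$, by induction on $n$.

  Since $W_n$ is a function of the first $n$ increments, it is independent of the next one, and
  $E \phi(W_{n+1})$ is the expectation of the transition operator applied to $\phi$, at $W_n$. From
  $w \ge 0$ the process is reflected to 0 with probability $\frac12 e^{-(w+\mu)/\sigma}$, because
  $-w$ does not exceed the mode $\mu$; otherwise it moves to $u > 0$ with the Laplace density at $u - w$.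
  Inserting the induction hypothesis and exchanging integrals, one is left with two identities:
  \[ 2 c_{n+1} = e^{-\mu/\sigma} \Big(c_n + \int g_n(y) e^{-y/\sigma} dy\Big), \qquad
     2\sigma g_{n+1}(u) = c_n e^{-|u-\mu|/\sigma} + \int g_n(y) e^{-|u-\mu-y|/\sigma} dy . \]

  The second one (\<open>lindley_density_Suc\<close>) is the analytic core. Put $v = u - \mu$. The kernel
  $e^{-|v-y|/\sigma}$ factorises on either side of $v$, so a piece of $g_n$ to the right of $v$
  contributes $e^{v/\sigma} A^{(2)}$ and a piece to the left $e^{-v/\sigma} A^{(1)}$; the piece that
  contains $v$ is split at $v$. Its antiderivatives are powers and incomplete Gamma functions, and
  because $\Gamma(k+1,t) = k!\, e^{-t} \sum_{l \le k} t^l/l!$ their values at $v$ are again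
  exponential polynomials in $v$. Collecting the coefficient of each power of $v - n\mu$ gives the
  recursion for the coefficients with $j \ge 1$ (\<open>exp_poly_recursion\<close>); the constant coefficients
  also absorb the contributions of the other pieces and of the atom. The intervals fit together
  because $u$ lies in the interval with index $i \ge 2$ at level $n + 1$ if and only if $v$ lies in
  the interval with index $i - 1$ at level $n$, while for $i = 1$ all mass is to the right of $v$.
  All integrals converge since the piece on the unbounded interval contains no growing exponential
  (\<open>a_unbounded_piece\<close>).
\<close>

section \<open>The incomplete Gamma function and its primitives\<close>

text \<open>The closed form of the upper incomplete Gamma function at $k + 1$. It is the reason
  why the family of exponential polynomials is stable under convolution with the Laplace
  kernel.\<close>
definition upper_gamma :: "nat \<Rightarrow> real \<Rightarrow> real" where
  "upper_gamma k y = fact k * exp (- y) * (\<Sum>l\<le>k. y ^ l / fact l)"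

lemma upper_gamma_Suc:
  "upper_gamma (Suc k) y = real (Suc k) * upper_gamma k y + y ^ Suc k * exp (- y)"
proof -
  have "upper_gamma (Suc k) y = fact (Suc k) * exp (- y) * (\<Sum>l\<le>k. y ^ l / fact l) + y ^ Suc k * exp (- y)"
    by (simp add: upper_gamma_def distrib_left del: fact_Suc)
  then show ?thesis by (simp add: upper_gamma_def)
qed

lemma DERIV_upper_gamma:
  "(upper_gamma k has_real_derivative - (y ^ k * exp (- y))) (at y)"
proof (induction k)
  case 0
  show ?case unfolding upper_gamma_def by (auto intro!: derivative_eq_intros)
next
  case (Suc k)
  have "upper_gamma (Suc k) = (\<lambda>y. real (Suc k) * upper_gamma k y + y ^ Suc k * exp (- y))"
    by (simp add: fun_eq_iff upper_gamma_Suc)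
  moreover have "((\<lambda>y. real (Suc k) * upper_gamma k y + y ^ Suc k * exp (- y))
      has_real_derivative - (y ^ Suc k * exp (- y))) (at y)"
    by (rule derivative_eq_intros Suc refl)+ (simp add: algebra_simps)
  ultimately show ?case by simp
qed

lemma upper_gamma_at_top: "(upper_gamma k \<longlongrightarrow> 0) at_top"
proof -
  have "upper_gamma k = (\<lambda>y. fact k * (\<Sum>l\<le>k. (y ^ l / exp y) / fact l))"
    by (simp add: fun_eq_iff upper_gamma_def exp_minus field_simps sum_distrib_left sum_divide_distrib)
  moreover have "((\<lambda>y::real. fact k * (\<Sum>l\<le>k. (y ^ l / exp y) / fact l)) \<longlongrightarrow>
      fact k * (\<Sum>l\<le>k. 0 / fact l)) at_top"
    by (intro tendsto_intros tendsto_power_div_exp_0) auto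
  ultimately show ?thesis by simp
qed

lemma set_integrable_power_exp:
  "set_integrable lborel {p..} (\<lambda>t::real. t ^ k * exp (- t))"
proof -
  have "set_integrable lborel {0..} (\<lambda>t::real. t ^ k * exp (- t))"
    unfolding set_integrable_def
  proof (rule integrableI_nonneg)
    show "(\<integral>\<^sup>+ t. ennreal (indicator {0..} t *\<^sub>R (t ^ k * exp (- t))) \<partial>lborel) < \<infinity>"
    proof -
      have "(\<integral>\<^sup>+ t. ennreal (indicator {0..} t *\<^sub>R (t ^ k * exp (- t))) \<partial>lborel) =
          (\<integral>\<^sup>+ t. ennreal (t ^ k * exp (- t)) * indicator {0..} t \<partial>lborel)"
        by (intro nn_integral_cong) (auto simp: indicator_def)
      then show ?thesis by (simp add: nn_intergal_power_times_exp_Ici)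
    qed
  qed (auto simp: indicator_def)
  moreover have "set_integrable lborel {min p 0..0} (\<lambda>t::real. t ^ k * exp (- t))"
    by (intro borel_integrable_atLeastAtMost' continuous_intros)
  ultimately have "set_integrable lborel ({min p 0..0} \<union> {0..}) (\<lambda>t::real. t ^ k * exp (- t))"
    by (intro set_integrable_Un) auto
  then show ?thesis by (rule set_integrable_subset) auto
qed

text \<open>The affine substitution $t = r (y - s)$ carries the Gamma integrand to this
  one.\<close>
lemma set_integrable_shifted_power_exp:
  fixes s r p :: real
  assumes "r > 0"
  shows "set_integrable lborel {p..} (\<lambda>y. (y - s) ^ k * exp (- r * y))"
proof -
  have "integrable lborel (\<lambda>y. indicator {r * (p - s)..} (- r * s + r * y) *\<^sub>R
      ((- r * s + r * y) ^ k * exp (- (- r * s + r * y))))"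
    using assms
    by (intro lborel_integrable_real_affine[OF set_integrable_power_exp[unfolded set_integrable_def]]) simp
  then have "integrable lborel (\<lambda>y. (exp (- r * s) / r ^ k) * (indicator {r * (p - s)..} (- r * s + r * y) *\<^sub>R
      ((- r * s + r * y) ^ k * exp (- (- r * s + r * y)))))"
    by (rule integrable_mult_right)
  also have "(\<lambda>y. (exp (- r * s) / r ^ k) * (indicator {r * (p - s)..} (- r * s + r * y) *\<^sub>R
      ((- r * s + r * y) ^ k * exp (- (- r * s + r * y))))) =
      (\<lambda>y. indicator {p..} y *\<^sub>R ((y - s) ^ k * exp (- r * y)))"
  proof
    fix y
    have ind: "indicator {r * (p - s)..} (- r * s + r * y) = (indicator {p..} y :: real)"
      using assms by (simp add: indicator_def flip: right_diff_distrib)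
    have e: "- r * s + r * y = r * (y - s)" by (simp add: algebra_simps)
    have E: "exp (- r * s) * exp (- (r * (y - s))) = exp (- r * y)"
      by (simp add: exp_add[symmetric] algebra_simps)
    have "exp (- r * s) / r ^ k * ((r * (y - s)) ^ k * exp (- (r * (y - s)))) =
        (y - s) ^ k * (exp (- r * s) * exp (- (r * (y - s))))"
      using assms by (simp add: power_mult_distrib)
    then show "(exp (- r * s) / r ^ k) * (indicator {r * (p - s)..} (- r * s + r * y) *\<^sub>R
      ((- r * s + r * y) ^ k * exp (- (- r * s + r * y)))) =
      indicator {p..} y *\<^sub>R ((y - s) ^ k * exp (- r * y))"
      unfolding ind unfolding e E by (cases "p \<le> y") (simp_all only: indicator_simps atLeast_iff scaleR_one scaleR_zero_left mult_zero_right not_False_eq_True)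
  qed
  finally show ?thesis by (simp add: set_integrable_def)
qed

lemma set_integral_Ioi_FTC:
  fixes f F :: "real \<Rightarrow> real"
  assumes F: "\<And>y. (F has_real_derivative f y) (at y)" and f: "continuous_on UNIV f"
    and int: "set_integrable lborel {p..} f" and lim: "(F \<longlongrightarrow> B) at_top"
  shows "(LBINT y:{p<..}. f y) = B - F p"
proof -
  have "(LBINT y=ereal p..\<infinity>. f y) = B - F p"
  proof (rule interval_integral_FTC_integrable)
    show "set_integrable lborel (einterval (ereal p) \<infinity>) f"
      using int by (rule set_integrable_subset) auto
    show "(F has_vector_derivative f y) (at y)" for y
      using F by (simp add: has_real_derivative_iff_has_vector_derivative)
    show "isCont f y" for y
      using f by (simp add: continuous_on_eq_continuous_at)
    have "isCont F p" by (rule DERIV_isCont[OF F])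
    then show "((F \<circ> real_of_ereal) \<longlongrightarrow> F p) (at_right (ereal p))"
      by (simp only: ereal_tendsto_simps1 isCont_def filterlim_at_split)
    show "((F \<circ> real_of_ereal) \<longlongrightarrow> B) (at_left \<infinity>)"
      using lim by (simp add: ereal_tendsto_simps1)
  qed simp
  then show ?thesis by (simp add: interval_integral_to_infinity_eq)
qed

lemma set_integral_Ici_FTC:
  fixes f F :: "real \<Rightarrow> real"
  assumes "\<And>y. (F has_real_derivative f y) (at y)" and "continuous_on UNIV f"
    and "set_integrable lborel {p..} f" and "(F \<longlongrightarrow> B) at_top"
  shows "(LBINT y:{p..}. f y) = B - F p"
proof -
  have "(LBINT y:{p..}. f y) = (LBINT y:{p<..}. f y)"
    by (rule set_integral_discrete_difference[where X="{p}"]) auto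
  then show ?thesis using set_integral_Ioi_FTC[OF assms] by simp
qed

lemma set_integral_Ioc_FTC:
  fixes f F :: "real \<Rightarrow> real"
  assumes F: "\<And>y. (F has_real_derivative f y) (at y)" and f: "continuous_on UNIV f"
    and "p \<le> q"
  shows "(LBINT y:{p<..q}. f y) = F q - F p"
proof -
  have "(LBINT y=ereal p..ereal q. f y) = F q - F p"
  proof (rule interval_integral_FTC_finite)
    show "continuous_on {min p q..max p q} f"
      using f by (rule continuous_on_subset) simp
    show "(F has_vector_derivative f y) (at y within {min p q..max p q})" for y
      using F by (simp add: has_real_derivative_iff_has_vector_derivative has_vector_derivative_at_within)
  qed
  then show ?thesis using \<open>p \<le> q\<close> by (simp add: interval_integral_Ioc)
qed

text \<open>Both sides have derivative $- y^k e^{-y}$ and vanish at infinity.\<close>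
lemma inc_Gamma_ereal: "inc_Gamma (1 + k) (ereal y) = upper_gamma k y"
proof -
  have "(LBINT t:{y<..}. t ^ k * exp (- t)) = (- 0) - (- upper_gamma k y)"
  proof (rule set_integral_Ioi_FTC)
    show "((\<lambda>y. - upper_gamma k y) has_real_derivative t ^ k * exp (- t)) (at t)" for t
      using DERIV_minus[OF DERIV_upper_gamma[of k t]] by simp
    show "((\<lambda>y. - upper_gamma k y) \<longlongrightarrow> - 0) at_top"
      by (intro tendsto_minus upper_gamma_at_top)
    show "set_integrable lborel {y..} (\<lambda>t. t ^ k * exp (- t))"
      by (rule set_integrable_power_exp)
  qed (intro continuous_intros)
  then show ?thesis by (simp add: inc_Gamma_def interval_integral_to_infinity_eq)
qed

lemma inc_Gamma_infinity: "inc_Gamma m \<infinity> = 0"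
  by (simp add: inc_Gamma_def)

lemma gam_minus_ereal:
  "gam_minus \<mu> \<sigma> n k (ereal y) = exp (- 2 * real n * \<mu> / \<sigma>) * \<sigma> ^ (k + 1) / 2 ^ (k + 1) *
     upper_gamma k (2 / \<sigma> * (y - real n * \<mu>))"
  by (simp only: gam_minus_def inc_Gamma_ereal ereal_minus times_ereal.simps)

lemma gam_plus_ereal:
  "gam_plus \<mu> \<sigma> n k (ereal y) = exp (2 * real n * \<mu> / \<sigma>) * \<sigma> ^ (k + 1) * (- 1) ^ k / 2 ^ (k + 1) *
     upper_gamma k (- 2 / \<sigma> * (y - real n * \<mu>))"
  by (simp only: gam_plus_def inc_Gamma_ereal ereal_minus times_ereal.simps)

lemma pow_term_ereal: "pow_term \<mu> n k (ereal y) = (y - real n * \<mu>) ^ (k + 1) / real (k + 1)"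
  by (simp add: pow_term_def)

lemma DERIV_pow_term:
  "((\<lambda>y. pow_term \<mu> n k (ereal y)) has_real_derivative (y - real n * \<mu>) ^ k) (at y)"
proof -
  have "((\<lambda>y. (y - real n * \<mu>) ^ (k + 1)) has_real_derivative real (k + 1) * (y - real n * \<mu>) ^ k) (at y)"
  proof -
    have "((\<lambda>y. y - real n * \<mu>) has_real_derivative 1) (at y)"
      by (auto intro!: derivative_eq_intros)
    from DERIV_power_Suc[OF this, of k] show ?thesis by simp
  qed
  from DERIV_cdivide[OF this, of "real (k + 1)"] show ?thesis
    unfolding pow_term_ereal by simp
qed

lemma scaled_power:
  fixes q r w :: real
  assumes "q * r = 1"
  shows "q ^ (k + 1) * r * (r * w) ^ k = w ^ k"
proof -
  have "q ^ (k + 1) * r * (r * w) ^ k = (q * r) ^ (k + 1) * w ^ k"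
    by (simp only: power_mult_distrib power_add power_one_right mult_ac)
  then show ?thesis using assms by simp
qed

lemma DERIV_gam_minus:
  assumes "\<sigma> > 0"
  shows "((\<lambda>y. gam_minus \<mu> \<sigma> n k (ereal y)) has_real_derivative
    - ((y - real n * \<mu>) ^ k * exp (- 2 * y / \<sigma>))) (at y)"
proof -
  let ?w = "\<lambda>y. 2 / \<sigma> * (y - real n * \<mu>)"
  have "((\<lambda>y. upper_gamma k (?w y)) has_real_derivative - (?w y ^ k * exp (- ?w y)) * (2 / \<sigma>)) (at y)"
    using assms by (intro DERIV_chain2[OF DERIV_upper_gamma]) (auto intro!: derivative_eq_intros)
  then have "((\<lambda>y. gam_minus \<mu> \<sigma> n k (ereal y)) has_real_derivative
      exp (- 2 * real n * \<mu> / \<sigma>) * \<sigma> ^ (k + 1) / 2 ^ (k + 1) * (- (?w y ^ k * exp (- ?w y)) * (2 / \<sigma>))) (at y)"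
    unfolding gam_minus_ereal by (rule DERIV_cmult)
  moreover have "exp (- 2 * real n * \<mu> / \<sigma>) * exp (- ?w y) = exp (- 2 * y / \<sigma>)"
    using assms by (simp add: exp_add[symmetric] field_simps)
  then have "exp (- 2 * real n * \<mu> / \<sigma>) * \<sigma> ^ (k + 1) / 2 ^ (k + 1) * (- (?w y ^ k * exp (- ?w y)) * (2 / \<sigma>))
      = - ((\<sigma> ^ (k + 1) / 2 ^ (k + 1) * (2 / \<sigma>) * ?w y ^ k) * exp (- 2 * y / \<sigma>))"
    by (simp add: field_simps)
  moreover have "\<sigma> ^ (k + 1) / 2 ^ (k + 1) * (2 / \<sigma>) * ?w y ^ k = (y - real n * \<mu>) ^ k"
    unfolding power_divide[symmetric] using assms by (intro scaled_power) simp
  ultimately show ?thesis by simp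
qed

lemma DERIV_gam_plus:
  assumes "\<sigma> > 0"
  shows "((\<lambda>y. gam_plus \<mu> \<sigma> n k (ereal y)) has_real_derivative
    (y - real n * \<mu>) ^ k * exp (2 * y / \<sigma>)) (at y)"
proof -
  let ?w = "\<lambda>y. - 2 / \<sigma> * (y - real n * \<mu>)"
  have "((\<lambda>y. upper_gamma k (?w y)) has_real_derivative - (?w y ^ k * exp (- ?w y)) * (- 2 / \<sigma>)) (at y)"
    using assms by (intro DERIV_chain2[OF DERIV_upper_gamma]) (auto intro!: derivative_eq_intros)
  then have "((\<lambda>y. gam_plus \<mu> \<sigma> n k (ereal y)) has_real_derivative
      exp (2 * real n * \<mu> / \<sigma>) * \<sigma> ^ (k + 1) * (- 1) ^ k / 2 ^ (k + 1) *
        (- (?w y ^ k * exp (- ?w y)) * (- 2 / \<sigma>))) (at y)"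
    unfolding gam_plus_ereal by (rule DERIV_cmult)
  moreover have "exp (2 * real n * \<mu> / \<sigma>) * exp (- ?w y) = exp (2 * y / \<sigma>)"
    using assms by (simp add: exp_add[symmetric] field_simps)
  then have "exp (2 * real n * \<mu> / \<sigma>) * \<sigma> ^ (k + 1) * (- 1) ^ k / 2 ^ (k + 1) *
        (- (?w y ^ k * exp (- ?w y)) * (- 2 / \<sigma>))
      = (\<sigma> ^ (k + 1) / 2 ^ (k + 1) * (2 / \<sigma>) * ((- 1) ^ k * ?w y ^ k)) * exp (2 * y / \<sigma>)"
    by (simp add: field_simps)
  moreover have "(- 1) ^ k * ?w y ^ k = (2 / \<sigma> * (y - real n * \<mu>)) ^ k"
    by (simp add: power_mult_distrib[symmetric] algebra_simps)
  then have "\<sigma> ^ (k + 1) / 2 ^ (k + 1) * (2 / \<sigma>) * ((- 1) ^ k * ?w y ^ k) = (y - real n * \<mu>) ^ k"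
    unfolding power_divide[symmetric] using assms by (simp only:) (intro scaled_power, simp)
  ultimately show ?thesis by simp
qed

lemma gam_minus_infinity: "\<sigma> > 0 \<Longrightarrow> gam_minus \<mu> \<sigma> n k \<infinity> = 0"
  by (simp add: gam_minus_def inc_Gamma_infinity)

lemma gam_minus_at_top:
  assumes "\<sigma> > 0"
  shows "((\<lambda>y. gam_minus \<mu> \<sigma> n k (ereal y)) \<longlongrightarrow> 0) at_top"
proof -
  have "filterlim (\<lambda>y. 2 / \<sigma> * (y - real n * \<mu>)) at_top at_top"
    unfolding filterlim_at_top eventually_at_top_linorder
  proof
    fix Z
    show "\<exists>N. \<forall>y\<ge>N. Z \<le> 2 / \<sigma> * (y - real n * \<mu>)"
      using assms by (intro exI[of _ "real n * \<mu> + Z * \<sigma> / 2"]) (simp add: field_simps)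
  qed
  then have "((\<lambda>y. upper_gamma k (2 / \<sigma> * (y - real n * \<mu>))) \<longlongrightarrow> 0) at_top"
    by (rule filterlim_compose[OF upper_gamma_at_top])
  then show ?thesis unfolding gam_minus_ereal by (rule tendsto_mult_right_zero)
qed

lemma scaled_power_cancel:
  fixes q r w F G :: real
  assumes "q * r = 1" and "l \<le> k"
  shows "q ^ (k + 1) * (F * ((r * w) ^ l / G)) = F / G * q ^ (k + 1 - l) * w ^ l"
proof -
  have "q ^ (k + 1) = q ^ (k + 1 - l) * q ^ l"
    using assms(2) by (simp add: power_add[symmetric] del: power_Suc)
  moreover have "q ^ l * r ^ l = 1"
    using assms(1) by (simp add: power_mult_distrib[symmetric])
  then have "q ^ (k + 1 - l) * q ^ l * (F * (r ^ l * w ^ l / G)) = F / G * q ^ (k + 1 - l) * w ^ l"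
    by (metis (no_types, opaque_lifting) mult.assoc mult.left_commute mult.commute mult_1 times_divide_eq_right times_divide_eq_left)
  ultimately show ?thesis by (simp add: power_mult_distrib)
qed

text \<open>The boundary value of a Gamma antiderivative at the moving endpoint $v$ of a
  convolution integral becomes, after multiplication with the kernel factor, a polynomial in $v$
  times the opposite exponential. The coefficients are the factors $\frac{k!}{l!}
  (\sigma/2)^{k+1-l}$ of the recursion.\<close>
lemma exp_times_gam_minus:
  assumes "\<sigma> > 0"
  shows "exp (v / \<sigma>) * gam_minus \<mu> \<sigma> n k (ereal v) =
    exp (- v / \<sigma>) * (\<Sum>l\<le>k. fact k / fact l * (\<sigma> / 2) ^ (k + 1 - l) * (v - real n * \<mu>) ^ l)"
proof -
  let ?w = "v - real n * \<mu>"
  have E: "exp (v / \<sigma>) * (exp (- 2 * real n * \<mu> / \<sigma>) * exp (- (2 / \<sigma> * ?w))) = exp (- v / \<sigma>)"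
    using assms by (simp add: exp_add[symmetric] field_simps)
  have S: "(\<sigma> / 2) ^ (k + 1) * (fact k * ((2 / \<sigma> * ?w) ^ l / fact l)) =
      fact k / fact l * (\<sigma> / 2) ^ (k + 1 - l) * ?w ^ l" if "l \<le> k" for l
    using that assms by (intro scaled_power_cancel) auto
  have "exp (v / \<sigma>) * gam_minus \<mu> \<sigma> n k (ereal v) =
      (exp (v / \<sigma>) * (exp (- 2 * real n * \<mu> / \<sigma>) * exp (- (2 / \<sigma> * ?w)))) *
      (\<Sum>l\<le>k. (\<sigma> / 2) ^ (k + 1) * (fact k * ((2 / \<sigma> * ?w) ^ l / fact l)))"
    by (simp add: gam_minus_ereal upper_gamma_def power_divide sum_distrib_left mult_ac)
  also have "\<dots> = exp (- v / \<sigma>) * (\<Sum>l\<le>k. fact k / fact l * (\<sigma> / 2) ^ (k + 1 - l) * ?w ^ l)"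
    unfolding E by (intro arg_cong2[where f="(*)"] sum.cong S) auto
  finally show ?thesis .
qed

text \<open>The reflection $y \mapsto - y$ of the preceding expansion; it produces the
  alternating signs in the recursion for the coefficients of the growing exponential.\<close>
lemma exp_times_gam_plus:
  assumes "\<sigma> > 0"
  shows "exp (- v / \<sigma>) * gam_plus \<mu> \<sigma> n k (ereal v) =
    exp (v / \<sigma>) * (\<Sum>l\<le>k. (- 1) ^ (k + l) * (fact k / fact l) * (\<sigma> / 2) ^ (k + 1 - l) * (v - real n * \<mu>) ^ l)"
proof -
  let ?w = "v - real n * \<mu>"
  have E: "exp (- v / \<sigma>) * (exp (2 * real n * \<mu> / \<sigma>) * exp (- (- 2 / \<sigma> * ?w))) = exp (v / \<sigma>)"
    using assms by (simp add: exp_add[symmetric] field_simps)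
  have S: "(\<sigma> / 2) ^ (k + 1) * (- 1) ^ k * (fact k * ((- 2 / \<sigma> * ?w) ^ l / fact l)) =
      (- 1) ^ (k + l) * (fact k / fact l) * (\<sigma> / 2) ^ (k + 1 - l) * ?w ^ l" if "l \<le> k" for l
  proof -
    have "(\<sigma> / 2) ^ (k + 1) * (fact k * ((2 / \<sigma> * (- ?w)) ^ l / fact l)) =
        fact k / fact l * (\<sigma> / 2) ^ (k + 1 - l) * (- ?w) ^ l"
      using that assms by (intro scaled_power_cancel) auto
    moreover have "2 / \<sigma> * (- ?w) = - 2 / \<sigma> * ?w" by (simp only: minus_divide_left[symmetric] mult_minus_left mult_minus_right)
    moreover have "(- ?w) ^ l = (- 1) ^ l * ?w ^ l" by (rule power_minus)
    ultimately have "(\<sigma> / 2) ^ (k + 1) * (fact k * ((- 2 / \<sigma> * ?w) ^ l / fact l)) =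
        fact k / fact l * (\<sigma> / 2) ^ (k + 1 - l) * ((- 1) ^ l * ?w ^ l)"
      by (simp only:)
    then have "(- 1) ^ k * ((\<sigma> / 2) ^ (k + 1) * (fact k * ((- 2 / \<sigma> * ?w) ^ l / fact l))) =
        (- 1) ^ k * (fact k / fact l * (\<sigma> / 2) ^ (k + 1 - l) * ((- 1) ^ l * ?w ^ l))"
      by (rule arg_cong)
    then show ?thesis by (simp only: power_add[of "- 1"] mult_ac)
  qed
  have "exp (- v / \<sigma>) * gam_plus \<mu> \<sigma> n k (ereal v) =
      (exp (- v / \<sigma>) * (exp (2 * real n * \<mu> / \<sigma>) * exp (- (- 2 / \<sigma> * ?w)))) *
      (\<Sum>l\<le>k. (\<sigma> / 2) ^ (k + 1) * (- 1) ^ k * (fact k * ((- 2 / \<sigma> * ?w) ^ l / fact l)))"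
    by (simp only: gam_plus_ereal upper_gamma_def power_divide sum_distrib_left mult_ac
      times_divide_eq_left times_divide_eq_right divide_divide_eq_left)
  also have "\<dots> = exp (v / \<sigma>) * (\<Sum>l\<le>k. (- 1) ^ (k + l) * (fact k / fact l) * (\<sigma> / 2) ^ (k + 1 - l) * ?w ^ l)"
    unfolding E by (intro arg_cong2[where f="(*)"] sum.cong S) auto
  finally show ?thesis .
qed

section \<open>Exponential polynomials against the Laplace kernel\<close>

definition exp_poly :: "real \<Rightarrow> real \<Rightarrow> (nat \<Rightarrow> real) \<Rightarrow> (nat \<Rightarrow> real) \<Rightarrow> nat \<Rightarrow> real \<Rightarrow> real" where
  "exp_poly \<sigma> s \<alpha> \<beta> m y =
     (\<Sum>k<m. \<alpha> k * (y - s) ^ k * exp (y / \<sigma>) + \<beta> k * (y - s) ^ k * exp (- y / \<sigma>))"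

text \<open>Antiderivative of an exponential polynomial times $e^{-y/\sigma}$. It is a function
  of extended reals so that it can be evaluated at the right endpoint of the unbounded
  interval.\<close>
definition tilt_down_prim ::
    "real \<Rightarrow> real \<Rightarrow> nat \<Rightarrow> (nat \<Rightarrow> real) \<Rightarrow> (nat \<Rightarrow> real) \<Rightarrow> nat \<Rightarrow> ereal \<Rightarrow> real" where
  "tilt_down_prim \<mu> \<sigma> n \<alpha> \<beta> m y =
     (\<Sum>k<m. \<alpha> k * pow_term \<mu> n k y - \<beta> k * gam_minus \<mu> \<sigma> n k y)"

text \<open>Antiderivative of an exponential polynomial times $e^{y/\sigma}$.\<close>
definition tilt_up_prim ::
    "real \<Rightarrow> real \<Rightarrow> nat \<Rightarrow> (nat \<Rightarrow> real) \<Rightarrow> (nat \<Rightarrow> real) \<Rightarrow> nat \<Rightarrow> ereal \<Rightarrow> real" where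
  "tilt_up_prim \<mu> \<sigma> n \<alpha> \<beta> m y =
     (\<Sum>k<m. \<alpha> k * gam_plus \<mu> \<sigma> n k y + \<beta> k * pow_term \<mu> n k y)"

lemma f_piece_eq_exp_poly:
  "f_piece \<mu> \<sigma> x a b n i u =
     exp_poly \<sigma> (real n * \<mu>) (a n i) (b n i) (min n i) u / (2 * \<sigma>) ^ n * indicator (I_set \<mu> x n i) u"
  by (simp add: f_piece_def exp_poly_def sum_divide_distrib)

lemma A2_eq:
  "A2 \<mu> \<sigma> x n a b j =
     tilt_down_prim \<mu> \<sigma> n (a j) (b j) (min n j) (rend \<mu> x n j) -
     tilt_down_prim \<mu> \<sigma> n (a j) (b j) (min n j) (lend \<mu> x n j)"
  by (simp add: A2_def tilt_down_prim_def over_I_def sum_subtractf[symmetric] algebra_simps)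

lemma A1_eq:
  "A1 \<mu> \<sigma> x n a b j =
     tilt_up_prim \<mu> \<sigma> n (a j) (b j) (min n j) (rend \<mu> x n j) -
     tilt_up_prim \<mu> \<sigma> n (a j) (b j) (min n j) (lend \<mu> x n j)"
  by (simp add: A1_def tilt_up_prim_def over_I_def sum_subtractf[symmetric] algebra_simps)

lemma continuous_on_exp_poly: "continuous_on S (exp_poly \<sigma> s \<alpha> \<beta> m)"
proof -
  have "continuous_on S (\<lambda>y. \<Sum>k<m. \<alpha> k * (y - s) ^ k * exp (y * inverse \<sigma>) + \<beta> k * (y - s) ^ k * exp (- y * inverse \<sigma>))"
    by (intro continuous_intros)
  then show ?thesis by (simp add: exp_poly_def[abs_def] divide_inverse)
qed

lemma measurable_exp_poly [measurable]: "exp_poly \<sigma> s \<alpha> \<beta> m \<in> borel_measurable borel"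
  by (intro borel_measurable_continuous_onI continuous_on_exp_poly)

lemma DERIV_tilt_down_prim:
  assumes "\<sigma> > 0"
  shows "((\<lambda>y. tilt_down_prim \<mu> \<sigma> n \<alpha> \<beta> m (ereal y)) has_real_derivative
    exp_poly \<sigma> (real n * \<mu>) \<alpha> \<beta> m y * exp (- y / \<sigma>)) (at y)"
proof -
  have "((\<lambda>y. tilt_down_prim \<mu> \<sigma> n \<alpha> \<beta> m (ereal y)) has_real_derivative
    (\<Sum>k<m. \<alpha> k * (y - real n * \<mu>) ^ k - \<beta> k * - ((y - real n * \<mu>) ^ k * exp (- 2 * y / \<sigma>)))) (at y)"
    unfolding tilt_down_prim_def
    by (intro DERIV_sum DERIV_diff DERIV_cmult DERIV_pow_term DERIV_gam_minus assms)
  moreover have "exp (y / \<sigma>) * exp (- y / \<sigma>) = 1" "exp (- y / \<sigma>) * exp (- y / \<sigma>) = exp (- 2 * y / \<sigma>)"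
    by (simp_all add: exp_add[symmetric])
  then have "\<alpha> k * (y - real n * \<mu>) ^ k - \<beta> k * - ((y - real n * \<mu>) ^ k * exp (- 2 * y / \<sigma>)) =
     (\<alpha> k * (y - real n * \<mu>) ^ k * exp (y / \<sigma>) + \<beta> k * (y - real n * \<mu>) ^ k * exp (- y / \<sigma>)) * exp (- y / \<sigma>)" for k
    by (simp only: distrib_right mult.assoc mult_minus_right diff_minus_eq_add mult_1_right)
  ultimately show ?thesis by (simp only: exp_poly_def sum_distrib_right)
qed

lemma DERIV_tilt_up_prim:
  assumes "\<sigma> > 0"
  shows "((\<lambda>y. tilt_up_prim \<mu> \<sigma> n \<alpha> \<beta> m (ereal y)) has_real_derivative
    exp_poly \<sigma> (real n * \<mu>) \<alpha> \<beta> m y * exp (y / \<sigma>)) (at y)"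
proof -
  have "((\<lambda>y. tilt_up_prim \<mu> \<sigma> n \<alpha> \<beta> m (ereal y)) has_real_derivative
    (\<Sum>k<m. \<alpha> k * ((y - real n * \<mu>) ^ k * exp (2 * y / \<sigma>)) + \<beta> k * (y - real n * \<mu>) ^ k)) (at y)"
    unfolding tilt_up_prim_def
    by (intro DERIV_sum DERIV_add DERIV_cmult DERIV_pow_term DERIV_gam_plus assms)
  moreover have "exp (- y / \<sigma>) * exp (y / \<sigma>) = 1" "exp (y / \<sigma>) * exp (y / \<sigma>) = exp (2 * y / \<sigma>)"
    by (simp_all add: exp_add[symmetric])
  then have "\<alpha> k * ((y - real n * \<mu>) ^ k * exp (2 * y / \<sigma>)) + \<beta> k * (y - real n * \<mu>) ^ k =
     (\<alpha> k * (y - real n * \<mu>) ^ k * exp (y / \<sigma>) + \<beta> k * (y - real n * \<mu>) ^ k * exp (- y / \<sigma>)) * exp (y / \<sigma>)" for k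
    by (simp only: distrib_right mult.assoc mult_1_right)
  ultimately show ?thesis by (simp only: exp_poly_def sum_distrib_right)
qed

lemma tilt_down_prim_infinity:
  assumes "\<sigma> > 0" and "\<And>k. k < m \<Longrightarrow> \<alpha> k = 0"
  shows "tilt_down_prim \<mu> \<sigma> n \<alpha> \<beta> m \<infinity> = 0"
  using assms by (simp add: tilt_down_prim_def gam_minus_infinity)

lemma tilt_down_prim_at_top:
  assumes "\<sigma> > 0" and "\<And>k. k < m \<Longrightarrow> \<alpha> k = 0"
  shows "((\<lambda>y. tilt_down_prim \<mu> \<sigma> n \<alpha> \<beta> m (ereal y)) \<longlongrightarrow> 0) at_top"
proof -
  have "(\<lambda>y. tilt_down_prim \<mu> \<sigma> n \<alpha> \<beta> m (ereal y)) = (\<lambda>y. \<Sum>k<m. - \<beta> k * gam_minus \<mu> \<sigma> n k (ereal y))"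
    using assms by (simp add: tilt_down_prim_def fun_eq_iff)
  moreover have "((\<lambda>y. \<Sum>k<m. - \<beta> k * gam_minus \<mu> \<sigma> n k (ereal y)) \<longlongrightarrow> (\<Sum>k<m. - \<beta> k * 0)) at_top"
    by (intro tendsto_intros gam_minus_at_top assms)
  ultimately show ?thesis by simp
qed

lemma exp_poly_decaying:
  assumes "\<And>k. k < m \<Longrightarrow> \<alpha> k = 0"
  shows "exp_poly \<sigma> s \<alpha> \<beta> m y = (\<Sum>k<m. \<beta> k * ((y - s) ^ k * exp (- (1 / \<sigma>) * y)))"
  using assms by (simp add: exp_poly_def mult.assoc)

lemma ereal_Ioc_cases:
  fixes q :: ereal
  assumes "ereal p \<le> q"
  obtains r where "q = ereal r" "p \<le> r" "{y. ereal p < ereal y \<and> ereal y \<le> q} = {p<..r}"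
  | "q = \<infinity>" "{y. ereal p < ereal y \<and> ereal y \<le> q} = {p<..}"
  using assms by (cases q) (auto simp: greaterThanAtMost_def greaterThan_def atMost_def)

text \<open>On an unbounded interval the growing exponentials must be absent; this is the form
  in which that condition occurs throughout.\<close>
lemma set_integrable_exp_poly:
  fixes q :: ereal
  assumes "\<sigma> > 0" and "ereal p \<le> q" and "q = \<infinity> \<Longrightarrow> \<forall>k<m. \<alpha> k = 0"
  shows "set_integrable lborel {y. ereal p < ereal y \<and> ereal y \<le> q} (exp_poly \<sigma> s \<alpha> \<beta> m)"
  using assms(2)
proof (cases rule: ereal_Ioc_cases)
  case (1 r)
  have "set_integrable lborel {p..r} (exp_poly \<sigma> s \<alpha> \<beta> m)"
    by (intro borel_integrable_atLeastAtMost' continuous_on_exp_poly)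
  then show ?thesis unfolding 1(3) by (rule set_integrable_subset) auto
next
  case 2
  have "set_integrable lborel {p..} (\<lambda>y. \<Sum>k<m. \<beta> k * ((y - s) ^ k * exp (- (1 / \<sigma>) * y)))"
    unfolding set_integrable_def scaleR_sum_right
  proof (intro Bochner_Integration.integrable_sum)
    show "integrable lborel (\<lambda>y. indicator {p..} y *\<^sub>R (\<beta> k * ((y - s) ^ k * exp (- (1 / \<sigma>) * y))))" for k
      using set_integrable_mult_right[OF set_integrable_shifted_power_exp[of "1 / \<sigma>" p s k], of "\<beta> k"] assms(1)
      unfolding set_integrable_def by simp
  qed
  moreover have "exp_poly \<sigma> s \<alpha> \<beta> m = (\<lambda>y. \<Sum>k<m. \<beta> k * ((y - s) ^ k * exp (- (1 / \<sigma>) * y)))"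
    using assms(3) 2(1) by (intro ext exp_poly_decaying) auto
  ultimately have "set_integrable lborel {p..} (exp_poly \<sigma> s \<alpha> \<beta> m)" by simp
  then show ?thesis unfolding 2(2) by (rule set_integrable_subset) auto
qed

lemma set_integrable_mult_bounded:
  fixes f g :: "real \<Rightarrow> real"
  assumes "set_integrable lborel S f" and [measurable]: "g \<in> borel_measurable borel"
    and "\<And>y. y \<in> S \<Longrightarrow> \<bar>g y\<bar> \<le> K"
  shows "set_integrable lborel S (\<lambda>y. f y * g y)"
  unfolding set_integrable_def
proof (rule Bochner_Integration.integrable_bound)
  let ?f = "\<lambda>y. indicator S y *\<^sub>R f y"
  have f: "integrable lborel ?f" using assms(1) by (simp add: set_integrable_def)
  then show "integrable lborel (\<lambda>y. K * ?f y)" by simp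
  have "(\<lambda>y. ?f y * g y) \<in> borel_measurable lborel"
    using f by (intro borel_measurable_times) auto
  then show "(\<lambda>y. indicator S y *\<^sub>R (f y * g y)) \<in> borel_measurable lborel"
    by (simp add: mult.assoc)
  show "AE y in lborel. norm (indicator S y *\<^sub>R (f y * g y)) \<le> norm (K * ?f y)"
  proof (intro AE_I2)
    fix y
    have "\<bar>f y\<bar> * \<bar>g y\<bar> \<le> \<bar>f y\<bar> * \<bar>K\<bar>" if "y \<in> S"
      using assms(3)[OF that] by (intro mult_left_mono) auto
    then show "norm (indicator S y *\<^sub>R (f y * g y)) \<le> norm (K * ?f y)"
      by (auto simp: indicator_def abs_mult mult.commute)
  qed
qed

lemma set_integral_tilt_down:
  fixes q :: ereal
  assumes "\<sigma> > 0" and "ereal p \<le> q" and "q = \<infinity> \<Longrightarrow> \<forall>k<m. \<alpha> k = 0"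
  shows "(LBINT y:{y. ereal p < ereal y \<and> ereal y \<le> q}. exp_poly \<sigma> (real n * \<mu>) \<alpha> \<beta> m y * exp (- y / \<sigma>)) =
    tilt_down_prim \<mu> \<sigma> n \<alpha> \<beta> m q - tilt_down_prim \<mu> \<sigma> n \<alpha> \<beta> m (ereal p)"
proof -
  let ?f = "\<lambda>y. exp_poly \<sigma> (real n * \<mu>) \<alpha> \<beta> m y * exp (- y / \<sigma>)"
  have cont: "continuous_on UNIV ?f"
    using assms(1) by (intro continuous_intros continuous_on_exp_poly) auto
  from assms(2) show ?thesis
  proof (cases rule: ereal_Ioc_cases)
    case (1 r)
    then show ?thesis
      unfolding 1(3) unfolding 1(1)
      by (intro set_integral_Ioc_FTC DERIV_tilt_down_prim assms cont)
  next
    case 2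
    have zero: "k < m \<Longrightarrow> \<alpha> k = 0" for k using assms(3) 2(1) by simp
    have int: "set_integrable lborel {p..} ?f"
    proof (rule set_integrable_mult_bounded)
      have "set_integrable lborel {y. ereal (p - 1) < ereal y \<and> ereal y \<le> \<infinity>} (exp_poly \<sigma> (real n * \<mu>) \<alpha> \<beta> m)"
        using zero assms(1) by (intro set_integrable_exp_poly) auto
      then show "set_integrable lborel {p..} (exp_poly \<sigma> (real n * \<mu>) \<alpha> \<beta> m)"
        by (rule set_integrable_subset) auto
      show "\<bar>exp (- y / \<sigma>)\<bar> \<le> exp (- p / \<sigma>)" if "y \<in> {p..}" for y
        using that assms(1) by (simp add: divide_right_mono)
    qed simp
    show ?thesis
      unfolding 2(2) using set_integral_Ioi_FTC[OF DERIV_tilt_down_prim[OF assms(1)] cont int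
        tilt_down_prim_at_top[OF assms(1) zero]]
      by (simp only: 2(1) tilt_down_prim_infinity[OF assms(1) zero])
  qed
qed

lemma set_integral_tilt_up:
  assumes "\<sigma> > 0" and "p \<le> q"
  shows "(LBINT y:{p<..q}. exp_poly \<sigma> (real n * \<mu>) \<alpha> \<beta> m y * exp (y / \<sigma>)) =
    tilt_up_prim \<mu> \<sigma> n \<alpha> \<beta> m (ereal q) - tilt_up_prim \<mu> \<sigma> n \<alpha> \<beta> m (ereal p)"
  using assms by (intro set_integral_Ioc_FTC DERIV_tilt_up_prim continuous_intros continuous_on_exp_poly) auto

text \<open>To the left of the interval of integration the Laplace kernel factorises as
  $e^{v/\sigma} e^{-y/\sigma}$, so $v$ enters only through a scalar factor.\<close>
lemma convolution_above:
  fixes q :: ereal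
  assumes "\<sigma> > 0" and "ereal p \<le> q" and "q = \<infinity> \<Longrightarrow> \<forall>k<m. \<alpha> k = 0" and "v \<le> p"
  shows "(LBINT y:{y. ereal p < ereal y \<and> ereal y \<le> q}. exp_poly \<sigma> (real n * \<mu>) \<alpha> \<beta> m y * exp (- \<bar>v - y\<bar> / \<sigma>)) =
    exp (v / \<sigma>) * (tilt_down_prim \<mu> \<sigma> n \<alpha> \<beta> m q - tilt_down_prim \<mu> \<sigma> n \<alpha> \<beta> m (ereal p))"
proof -
  let ?S = "{y. ereal p < ereal y \<and> ereal y \<le> q}"
  have "exp_poly \<sigma> (real n * \<mu>) \<alpha> \<beta> m y * exp (- \<bar>v - y\<bar> / \<sigma>) =
      exp (v / \<sigma>) * (exp_poly \<sigma> (real n * \<mu>) \<alpha> \<beta> m y * exp (- y / \<sigma>))" if "y \<in> ?S" for y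
  proof -
    have "- \<bar>v - y\<bar> / \<sigma> = v / \<sigma> + (- y / \<sigma>)"
      using that assms(4) by (simp add: diff_divide_distrib[symmetric])
    then show ?thesis by (simp only: exp_add mult_ac)
  qed
  then have "(LBINT y:?S. exp_poly \<sigma> (real n * \<mu>) \<alpha> \<beta> m y * exp (- \<bar>v - y\<bar> / \<sigma>)) =
      (LBINT y:?S. exp (v / \<sigma>) * (exp_poly \<sigma> (real n * \<mu>) \<alpha> \<beta> m y * exp (- y / \<sigma>)))"
    by (intro set_lebesgue_integral_cong) (auto simp del: ereal_less_eq ereal_less)
  also have "\<dots> = exp (v / \<sigma>) * (LBINT y:?S. exp_poly \<sigma> (real n * \<mu>) \<alpha> \<beta> m y * exp (- y / \<sigma>))"
    by (rule set_integral_mult_right)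
  finally show ?thesis by (simp only: set_integral_tilt_down[OF assms(1-3)])
qed

text \<open>The mirror image: the kernel is $e^{-v/\sigma} e^{y/\sigma}$ when $v$ lies to the
  right of the interval.\<close>
lemma convolution_below:
  assumes "\<sigma> > 0" and "p \<le> q" and "q \<le> v"
  shows "(LBINT y:{p<..q}. exp_poly \<sigma> (real n * \<mu>) \<alpha> \<beta> m y * exp (- \<bar>v - y\<bar> / \<sigma>)) =
    exp (- v / \<sigma>) * (tilt_up_prim \<mu> \<sigma> n \<alpha> \<beta> m (ereal q) - tilt_up_prim \<mu> \<sigma> n \<alpha> \<beta> m (ereal p))"
proof -
  have "exp_poly \<sigma> (real n * \<mu>) \<alpha> \<beta> m y * exp (- \<bar>v - y\<bar> / \<sigma>) =
      exp (- v / \<sigma>) * (exp_poly \<sigma> (real n * \<mu>) \<alpha> \<beta> m y * exp (y / \<sigma>))" if "y \<in> {p<..q}" for y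
  proof -
    have "- \<bar>v - y\<bar> / \<sigma> = - v / \<sigma> + y / \<sigma>"
      using that assms(3) by (simp add: diff_divide_distrib)
    then show ?thesis by (simp only: exp_add mult_ac)
  qed
  then have "(LBINT y:{p<..q}. exp_poly \<sigma> (real n * \<mu>) \<alpha> \<beta> m y * exp (- \<bar>v - y\<bar> / \<sigma>)) =
      (LBINT y:{p<..q}. exp (- v / \<sigma>) * (exp_poly \<sigma> (real n * \<mu>) \<alpha> \<beta> m y * exp (y / \<sigma>)))"
    by (intro set_lebesgue_integral_cong) auto
  also have "\<dots> = exp (- v / \<sigma>) * (LBINT y:{p<..q}. exp_poly \<sigma> (real n * \<mu>) \<alpha> \<beta> m y * exp (y / \<sigma>))"
    by (rule set_integral_mult_right)
  finally show ?thesis by (simp only: set_integral_tilt_up[OF assms(1,2)])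
qed

lemma convolution_inside:
  fixes q :: ereal
  assumes "\<sigma> > 0" and "p \<le> v" and "ereal v \<le> q" and "q = \<infinity> \<Longrightarrow> \<forall>k<m. \<alpha> k = 0"
  shows "(LBINT y:{y. ereal p < ereal y \<and> ereal y \<le> q}. exp_poly \<sigma> (real n * \<mu>) \<alpha> \<beta> m y * exp (- \<bar>v - y\<bar> / \<sigma>)) =
    exp (v / \<sigma>) * (tilt_down_prim \<mu> \<sigma> n \<alpha> \<beta> m q - tilt_down_prim \<mu> \<sigma> n \<alpha> \<beta> m (ereal v)) +
    exp (- v / \<sigma>) * (tilt_up_prim \<mu> \<sigma> n \<alpha> \<beta> m (ereal v) - tilt_up_prim \<mu> \<sigma> n \<alpha> \<beta> m (ereal p))"
proof -
  let ?f = "\<lambda>y. exp_poly \<sigma> (real n * \<mu>) \<alpha> \<beta> m y * exp (- \<bar>v - y\<bar> / \<sigma>)"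
  let ?S = "{y. ereal p < ereal y \<and> ereal y \<le> q}" and ?T = "{y. ereal v < ereal y \<and> ereal y \<le> q}"
  have pq: "ereal p \<le> q" using assms(2,3) by (meson ereal_less_eq(3) order_trans)
  have S: "?S = {p<..v} \<union> ?T"
    using assms(2,3) by (auto intro: order_trans[of _ "ereal v"] order_le_less_trans[of p v])
  have int: "set_integrable lborel ?S ?f"
    using assms(1) by (intro set_integrable_mult_bounded[where K=1] set_integrable_exp_poly pq assms) auto
  have "(LBINT y:?S. ?f y) = (LBINT y:{p<..v}. ?f y) + (LBINT y:?T. ?f y)"
    unfolding S
  proof (rule set_integral_Un)
    show "set_integrable lborel {p<..v} ?f" "set_integrable lborel ?T ?f"
      using int unfolding S by (auto elim!: set_integrable_subset)
  qed auto
  then show ?thesis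
    using convolution_below[OF assms(1,2) order_refl, of n \<mu> \<alpha> \<beta> m]
      convolution_above[OF assms(1,3,4) order_refl, of n \<mu> \<beta>] by (simp only: add.commute)
qed

section \<open>The coefficient recursion as a polynomial identity\<close>

text \<open>A monomial of degree $k$ is mapped to a polynomial of degree $k + 1$; exchanging the
  two summations collects the contributions to a given power $w^j$, which come from $k \ge j -
  1$.\<close>
lemma polynomial_recursion:
  fixes \<gamma> \<gamma>' :: "nat \<Rightarrow> real" and C :: "nat \<Rightarrow> nat \<Rightarrow> real"
  assumes "\<gamma>' 0 = E * (U + (\<Sum>k<m. \<gamma> k * C k 0))"
    and "\<And>j. j \<in> {1..m} \<Longrightarrow> \<gamma>' j = E * (\<Sum>k=j-1..<m. \<gamma> k * C k j)"
  shows "(\<Sum>j<Suc m. \<gamma>' j * w ^ j) = E * (U + (\<Sum>k<m. \<gamma> k * (\<Sum>l\<le>Suc k. C k l * w ^ l)))"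
proof -
  \<comment> \<open>Only the terms with $l \ge 1$ are exchanged; the constant terms make up \<open>\<gamma>' 0\<close>.\<close>
  have "(\<Sum>k<m. \<gamma> k * (\<Sum>l=1..Suc k. C k l * w ^ l)) = (\<Sum>k<m. \<Sum>l\<in>{l\<in>{1..m}. l \<le> Suc k}. \<gamma> k * C k l * w ^ l)"
  proof (intro sum.cong refl)
    fix k assume "k \<in> {..<m}"
    then have "{l\<in>{1..m}. l \<le> Suc k} = {1..Suc k}" by auto
    then show "\<gamma> k * (\<Sum>l=1..Suc k. C k l * w ^ l) = (\<Sum>l\<in>{l\<in>{1..m}. l \<le> Suc k}. \<gamma> k * C k l * w ^ l)"
      by (simp only: sum_distrib_left mult.assoc)
  qed
  also have "\<dots> = (\<Sum>l=1..m. \<Sum>k\<in>{k\<in>{..<m}. l \<le> Suc k}. \<gamma> k * C k l * w ^ l)"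
    by (rule sum.swap_restrict) auto
  also have "\<dots> = (\<Sum>l=1..m. (\<Sum>k=l-1..<m. \<gamma> k * C k l) * w ^ l)"
    by (intro sum.cong refl) (auto simp: sum_distrib_right intro!: sum.cong)
  finally have inner: "(\<Sum>k<m. \<gamma> k * (\<Sum>l=1..Suc k. C k l * w ^ l)) = \<dots>" .
  have "(\<Sum>l=1..m. \<gamma>' l * w ^ l) = (\<Sum>l=1..m. E * ((\<Sum>k=l-1..<m. \<gamma> k * C k l) * w ^ l))"
    by (intro sum.cong refl) (simp only: assms(2) mult.assoc)
  then have swap: "E * (\<Sum>k<m. \<gamma> k * (\<Sum>l=1..Suc k. C k l * w ^ l)) = (\<Sum>l=1..m. \<gamma>' l * w ^ l)"
    by (simp only: inner sum_distrib_left[of E _ "{1..m}"])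
  have split: "sum g {..Suc k} = g 0 + sum g {1..Suc k}" for g :: "nat \<Rightarrow> real" and k
  proof -
    have "{..Suc k} = insert 0 {1..Suc k}" by auto
    then show ?thesis by simp
  qed
  have "(\<Sum>j<Suc m. \<gamma>' j * w ^ j) = \<gamma>' 0 + (\<Sum>l=1..m. \<gamma>' l * w ^ l)"
    by (simp add: sum.lessThan_Suc_shift sum.atLeast1_atMost_eq del: sum.lessThan_Suc)
  also have "\<dots> = E * (U + (\<Sum>k<m. \<gamma> k * (\<Sum>l\<le>Suc k. C k l * w ^ l)))"
    unfolding swap[symmetric] assms(1) split
    by (simp add: distrib_left sum.distrib del: sum.cl_ivl_Suc)
  finally show ?thesis .
qed

text \<open>The pure power, which stems from integrating a monomial against a constant, is
  exactly the missing top term $l = k + 1$ of the Gamma expansion.\<close>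
lemma pow_gam_plus_expansion:
  assumes "\<sigma> > 0"
  shows "exp (- v / \<sigma>) * gam_plus \<mu> \<sigma> n k (ereal v) - exp (v / \<sigma>) * pow_term \<mu> n k (ereal v) =
    exp (v / \<sigma>) * (\<Sum>l\<le>Suc k. ((- 1) ^ (k + l) * (fact k / fact l) * (\<sigma> / 2) ^ (k + 1 - l)) * (v - real n * \<mu>) ^ l)"
proof -
  have "(- 1) ^ (k + Suc k) * (fact k / fact (Suc k)) * (\<sigma> / 2) ^ (k + 1 - Suc k) = - (1 / real (k + 1))"
    by simp
  then show ?thesis
    unfolding exp_times_gam_plus[OF assms] pow_term_ereal sum.atMost_Suc distrib_left by simp
qed

lemma pow_gam_minus_expansion:
  assumes "\<sigma> > 0"
  shows "exp (v / \<sigma>) * gam_minus \<mu> \<sigma> n k (ereal v) + exp (- v / \<sigma>) * pow_term \<mu> n k (ereal v) =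
    exp (- v / \<sigma>) * (\<Sum>l\<le>Suc k. (fact k / fact l * (\<sigma> / 2) ^ (k + 1 - l)) * (v - real n * \<mu>) ^ l)"
proof -
  have "fact k / fact (Suc k) * (\<sigma> / 2) ^ (k + 1 - Suc k) = 1 / real (k + 1)"
    by simp
  then show ?thesis
    unfolding exp_times_gam_minus[OF assms] pow_term_ereal sum.atMost_Suc distrib_left by simp
qed

text \<open>The coefficient recursion in closed form: it encodes the part of the convolution
  that depends on the moving endpoint $v$, through the two antiderivatives at $v$. Everything
  that does not depend on $v$ is collected in $U$ and $L$ and only affects the constant
  coefficients.\<close>
lemma exp_poly_recursion:
  fixes \<alpha> \<beta> \<alpha>' \<beta>' :: "nat \<Rightarrow> real"
  assumes "\<sigma> > 0"
    and \<alpha>0: "\<alpha>' 0 = exp (- \<mu> / \<sigma>) * (U + (\<Sum>k<m. \<alpha> k * ((- 1) ^ k * fact k * (\<sigma> / 2) ^ (k + 1))))"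
    and \<alpha>: "\<And>j. j \<in> {1..m} \<Longrightarrow> \<alpha>' j = exp (- \<mu> / \<sigma>) *
      (\<Sum>k=j-1..<m. (- 1) ^ (k + j) * \<alpha> k * (fact k / fact j) * (\<sigma> / 2) ^ (k + 1 - j))"
    and \<beta>0: "\<beta>' 0 = exp (\<mu> / \<sigma>) * (L + (\<Sum>k<m. \<beta> k * (fact k * (\<sigma> / 2) ^ (k + 1))))"
    and \<beta>: "\<And>j. j \<in> {1..m} \<Longrightarrow> \<beta>' j = exp (\<mu> / \<sigma>) *
      (\<Sum>k=j-1..<m. \<beta> k * (fact k / fact j) * (\<sigma> / 2) ^ (k + 1 - j))"
  shows "exp_poly \<sigma> (real (n + 1) * \<mu>) \<alpha>' \<beta>' (Suc m) (v + \<mu>) =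
    exp (v / \<sigma>) * (U - tilt_down_prim \<mu> \<sigma> n \<alpha> \<beta> m (ereal v)) +
    exp (- v / \<sigma>) * (L + tilt_up_prim \<mu> \<sigma> n \<alpha> \<beta> m (ereal v))"
proof -
  let ?w = "v - real n * \<mu>"
  let ?Ca = "\<lambda>k l. (- 1) ^ (k + l) * (fact k / fact l) * (\<sigma> / 2) ^ (k + 1 - l) :: real"
  let ?Cb = "\<lambda>k l. fact k / fact l * (\<sigma> / 2) ^ (k + 1 - l) :: real"
  have w: "v + \<mu> - real (n + 1) * \<mu> = ?w" by (simp add: algebra_simps)
  have pa: "(\<Sum>j<Suc m. \<alpha>' j * ?w ^ j) = exp (- \<mu> / \<sigma>) * (U + (\<Sum>k<m. \<alpha> k * (\<Sum>l\<le>Suc k. ?Ca k l * ?w ^ l)))"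
    by (rule polynomial_recursion) (simp_all only: \<alpha>0 \<alpha> fact_0 div_by_1 add_0_right diff_zero mult_ac)
  have pb: "(\<Sum>j<Suc m. \<beta>' j * ?w ^ j) = exp (\<mu> / \<sigma>) * (L + (\<Sum>k<m. \<beta> k * (\<Sum>l\<le>Suc k. ?Cb k l * ?w ^ l)))"
    by (rule polynomial_recursion) (simp_all only: \<beta>0 \<beta> fact_0 div_by_1 add_0_right diff_zero mult_ac)
  have e1: "exp ((v + \<mu>) / \<sigma>) * exp (- \<mu> / \<sigma>) = exp (v / \<sigma>)"
    and e2: "exp (- (v + \<mu>) / \<sigma>) * exp (\<mu> / \<sigma>) = exp (- v / \<sigma>)"
    by (simp_all add: exp_add[symmetric] add_divide_distrib diff_divide_distrib)
  have sa: "exp (v / \<sigma>) * (\<Sum>k<m. \<alpha> k * (\<Sum>l\<le>Suc k. ?Ca k l * ?w ^ l)) =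
      (\<Sum>k<m. \<alpha> k * (exp (- v / \<sigma>) * gam_plus \<mu> \<sigma> n k (ereal v) - exp (v / \<sigma>) * pow_term \<mu> n k (ereal v)))"
    unfolding pow_gam_plus_expansion[OF assms(1)] sum_distrib_left[of "exp (v / \<sigma>)" _ "{..<m}"]
    by (intro sum.cong refl mult.left_commute)
  have sb: "exp (- v / \<sigma>) * (\<Sum>k<m. \<beta> k * (\<Sum>l\<le>Suc k. ?Cb k l * ?w ^ l)) =
      (\<Sum>k<m. \<beta> k * (exp (v / \<sigma>) * gam_minus \<mu> \<sigma> n k (ereal v) + exp (- v / \<sigma>) * pow_term \<mu> n k (ereal v)))"
    unfolding pow_gam_minus_expansion[OF assms(1)] sum_distrib_left[of "exp (- v / \<sigma>)" _ "{..<m}"]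
    by (intro sum.cong refl mult.left_commute)
  have "exp_poly \<sigma> (real (n + 1) * \<mu>) \<alpha>' \<beta>' (Suc m) (v + \<mu>) =
      exp ((v + \<mu>) / \<sigma>) * (\<Sum>j<Suc m. \<alpha>' j * ?w ^ j) + exp (- (v + \<mu>) / \<sigma>) * (\<Sum>j<Suc m. \<beta>' j * ?w ^ j)"
    unfolding exp_poly_def w sum.distrib sum_distrib_left by (simp only: mult_ac)
  also have "\<dots> = exp (v / \<sigma>) * (U + (\<Sum>k<m. \<alpha> k * (\<Sum>l\<le>Suc k. ?Ca k l * ?w ^ l))) +
      exp (- v / \<sigma>) * (L + (\<Sum>k<m. \<beta> k * (\<Sum>l\<le>Suc k. ?Cb k l * ?w ^ l)))"
    unfolding pa pb mult.assoc[symmetric] e1 e2 ..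
  also have "\<dots> = exp (v / \<sigma>) * (U - tilt_down_prim \<mu> \<sigma> n \<alpha> \<beta> m (ereal v)) +
    exp (- v / \<sigma>) * (L + tilt_up_prim \<mu> \<sigma> n \<alpha> \<beta> m (ereal v))"
    unfolding distrib_left sa sb tilt_down_prim_def tilt_up_prim_def
    by (simp add: algebra_simps sum.distrib sum_subtractf sum_distrib_left)
  finally show ?thesis .
qed

section \<open>The intervals\<close>

lemma lend_le_lend:
  assumes "0 \<le> \<mu>" "0 \<le> x" "i \<le> j" "j \<le> n + 1"
  shows "lend \<mu> x n i \<le> lend \<mu> x n j"
proof -
  have "(real i - 1) * \<mu> \<le> (real j - 1) * \<mu>"
    using assms by (intro mult_right_mono) auto
  moreover have "(real i - 1) * \<mu> \<le> real n * \<mu>" if "i \<le> n"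
    using that assms by (intro mult_right_mono) auto
  ultimately show ?thesis using assms by (auto simp: lend_def)
qed

lemma rend_eq_lend: "i \<le> n \<Longrightarrow> rend \<mu> x n i = lend \<mu> x n (i + 1)"
  by (auto simp: rend_def lend_def)

lemma lend_le_rend:
  assumes "0 \<le> \<mu>" "0 \<le> x" "i \<le> n + 1"
  shows "lend \<mu> x n i \<le> rend \<mu> x n i"
proof (cases "i \<le> n")
  case True
  then show ?thesis using lend_le_lend[of \<mu> x i "i + 1" n] assms by (simp add: rend_eq_lend)
qed (use assms in \<open>simp add: rend_def\<close>)

lemma rend_le_lend:
  assumes "0 \<le> \<mu>" "0 \<le> x" "i < j" "j \<le> n + 1"
  shows "rend \<mu> x n i \<le> lend \<mu> x n j"
  using lend_le_lend[of \<mu> x "i + 1" j n] assms by (simp add: rend_eq_lend)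

lemma lend_real: "lend \<mu> x n i = ereal (real_of_ereal (lend \<mu> x n i))"
  by (simp add: lend_def)

lemma rend_infinite_iff: "rend \<mu> x n i = \<infinity> \<longleftrightarrow> n < i"
  by (auto simp: rend_def)

lemma lend_nonneg:
  assumes "0 \<le> \<mu>" "0 < x" "1 \<le> i" "1 \<le> n"
  shows "0 \<le> lend \<mu> x n i"
  using assms by (auto simp: lend_def)

lemma I_set_pos:
  assumes "0 \<le> \<mu>" "0 < x" "1 \<le> i" "1 \<le> n" "u \<in> I_set \<mu> x n i"
  shows "0 < u"
  using lend_nonneg[OF assms(1-4)] assms(3,5) order_le_less_trans[of 0 "lend \<mu> x n i" "ereal u"]
  by (auto simp: I_set_def)

lemma I_set_disjoint:
  assumes "0 \<le> \<mu>" "0 < x" "1 \<le> i" "i < j" "j \<le> n + 1" "u \<in> I_set \<mu> x n i" "u \<in> I_set \<mu> x n j"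
  shows False
proof -
  have "ereal u \<le> rend \<mu> x n i" "lend \<mu> x n j < ereal u" using assms by (auto simp: I_set_def)
  moreover have "rend \<mu> x n i \<le> lend \<mu> x n j" using assms by (intro rend_le_lend) auto
  ultimately show False by order
qed

text \<open>Take the first interval whose right endpoint is not exceeded by $u$.\<close>
lemma I_set_cover_pos:
  assumes "0 \<le> \<mu>" "0 < x" "1 \<le> n" "0 < u"
  shows "\<exists>i\<in>{1..n + 1}. u \<in> I_set \<mu> x n i"
proof -
  define P where "P i \<longleftrightarrow> 1 \<le> i \<and> i \<le> n + 1 \<and> ereal u \<le> rend \<mu> x n i" for i
  define i where "i = (LEAST i. P i)"
  have "P (n + 1)" by (simp add: P_def rend_def)
  then have i: "P i" unfolding i_def by (rule LeastI)
  have "lend \<mu> x n i < ereal u"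
  proof (cases "i = 1")
    case True
    then show ?thesis using assms by (simp add: lend_def zero_ereal_def)
  next
    case False
    have "i - 1 < i" using i by (auto simp: P_def)
    then have "\<not> P (i - 1)" unfolding i_def by (rule not_less_Least)
    then have "rend \<mu> x n (i - 1) < ereal u" using i False by (auto simp: P_def)
    then show ?thesis using i False rend_eq_lend[of "i - 1" n \<mu> x] by (auto simp: P_def)
  qed
  then show ?thesis using i by (auto simp: P_def I_set_def intro!: bexI[of _ i])
qed

lemma I_set_cover:
  assumes "0 \<le> \<mu>" "0 < x" "1 \<le> n"
  shows "(\<Union>i\<in>{0..n + 1}. I_set \<mu> x n i) = {0..}"
proof (intro set_eqI iffI)
  fix u assume "u \<in> (\<Union>i\<in>{0..n + 1}. I_set \<mu> x n i)"
  then obtain i where "u \<in> I_set \<mu> x n i" by blast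
  then show "u \<in> {0..}"
    using I_set_pos[OF assms(1,2) _ assms(3), of i u] by (cases "i = 0") (auto simp: I_set_def)
next
  fix u :: real assume "u \<in> {0..}"
  show "u \<in> (\<Union>i\<in>{0..n + 1}. I_set \<mu> x n i)"
  proof (cases "u = 0")
    case True
    then show ?thesis by (auto simp: I_set_def intro!: bexI[of _ 0])
  next
    case False
    then have "0 < u" using \<open>u \<in> {0..}\<close> by simp
    from I_set_cover_pos[OF assms this] obtain i where "i \<in> {1..n + 1}" "u \<in> I_set \<mu> x n i" by blast
    then show ?thesis by (intro UN_I[of i]) auto
  qed
qed

lemma lend_Suc:
  assumes "1 \<le> i" shows "lend \<mu> x (n + 1) (i + 1) = lend \<mu> x n i + ereal \<mu>"
  using assms by (simp add: lend_def algebra_simps)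

lemma rend_Suc:
  assumes "1 \<le> i" shows "rend \<mu> x (n + 1) (i + 1) = rend \<mu> x n i + ereal \<mu>"
  using assms by (simp add: rend_def algebra_simps)

text \<open>The convolution with the kernel centred at $\mu$ shifts every breakpoint by $\mu$.
  The interval with index 1 has no counterpart one level below: it is mapped to the nonpositive
  half-line.\<close>
lemma I_set_Suc_shift:
  assumes "1 \<le> i"
  shows "u \<in> I_set \<mu> x (n + 1) (i + 1) \<longleftrightarrow> u - \<mu> \<in> I_set \<mu> x n i"
proof -
  have "lend \<mu> x n i + ereal \<mu> < ereal u \<longleftrightarrow> lend \<mu> x n i < ereal (u - \<mu>)"
    by (cases "lend \<mu> x n i") auto
  moreover have "ereal u \<le> rend \<mu> x n i + ereal \<mu> \<longleftrightarrow> ereal (u - \<mu>) \<le> rend \<mu> x n i"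
    by (cases "rend \<mu> x n i") auto
  ultimately show ?thesis
    using assms by (simp add: I_set_def lend_Suc[OF assms, simplified] rend_Suc[OF assms, simplified])
qed

section \<open>Existence of the coefficients\<close>

text \<open>The relations determine level $n + 1$ from level $n$, so primitive recursion on
  triples of coefficient families provides a solution. The recursion starts at level 1; level 0
  is a copy of it.\<close>
lemma lindley_coeffs_exist: "\<exists>a b c. lindley_coeffs \<mu> \<sigma> x a b c"
proof -
  define A :: "nat \<Rightarrow> (nat \<Rightarrow> nat \<Rightarrow> real) \<Rightarrow> (nat \<Rightarrow> nat \<Rightarrow> real) \<Rightarrow> real \<Rightarrow> nat \<Rightarrow> nat \<Rightarrow> real"
    where "A n a b c i j = (if j = 0 then exp (- \<mu> / \<sigma>) *
           ((\<Sum>j = i..n + 1. A2 \<mu> \<sigma> x n a b j)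
            + (\<Sum>k<min n (i - 1).
                 a (i - 1) k *
                   (pow_term \<mu> n k (rend \<mu> x n (i - 1)) + (- 1) ^ k * fact k * (\<sigma> / 2) ^ (k + 1))
                 - b (i - 1) k * gam_minus \<mu> \<sigma> n k (rend \<mu> x n (i - 1)))
            + (2 * \<sigma>) ^ n * c * (if i = 1 then 1 else 0))
       else exp (- \<mu> / \<sigma>) *
             (\<Sum>k = j - 1..<min n (i - 1).
                (- 1) ^ (k + j) * a (i - 1) k * (fact k / fact j) * (\<sigma> / 2) ^ (k + 1 - j)))" for n a b c i j
  define B :: "nat \<Rightarrow> (nat \<Rightarrow> nat \<Rightarrow> real) \<Rightarrow> (nat \<Rightarrow> nat \<Rightarrow> real) \<Rightarrow> real \<Rightarrow> nat \<Rightarrow> nat \<Rightarrow> real"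
    where "B n a b c i j = (if j = 0 then exp (\<mu> / \<sigma>) *
           ((\<Sum>j = 1..i - 2. A1 \<mu> \<sigma> x n a b j)
            - (\<Sum>k<min n (i - 1).
                 b (i - 1) k *
                   (pow_term \<mu> n k (lend \<mu> x n (i - 1)) - fact k * (\<sigma> / 2) ^ (k + 1))
                 + a (i - 1) k * gam_plus \<mu> \<sigma> n k (lend \<mu> x n (i - 1)))
            + (2 * \<sigma>) ^ n * c * (1 - (if i = 1 then 1 else 0)))
       else exp (\<mu> / \<sigma>) *
             (\<Sum>k = j - 1..<min n (i - 1).
                b (i - 1) k * (fact k / fact j) * (\<sigma> / 2) ^ (k + 1 - j)))" for n a b c i j
  define C :: "nat \<Rightarrow> (nat \<Rightarrow> nat \<Rightarrow> real) \<Rightarrow> (nat \<Rightarrow> nat \<Rightarrow> real) \<Rightarrow> real \<Rightarrow> real"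
    where "C n a b c = exp (- \<mu> / \<sigma>) / (2 * (2 * \<sigma>) ^ n) *
         ((\<Sum>j = 1..n + 1. A2 \<mu> \<sigma> x n a b j) + (2 * \<sigma>) ^ n * c)" for n a b c
  define step where "step n = (\<lambda>(a, b, c). (A (n + 1) a b c, B (n + 1) a b c, C (n + 1) a b c))" for n
  define init :: "(nat \<Rightarrow> nat \<Rightarrow> real) \<times> (nat \<Rightarrow> nat \<Rightarrow> real) \<times> real" where
    "init = (\<lambda>i j. if i = 1 then exp (- (\<mu> + x) / \<sigma>) else 0,
      \<lambda>i j. if i = 1 then 0 else exp ((\<mu> + x) / \<sigma>), exp (- (\<mu> + x) / \<sigma>) / 2)"
  define T where "T n = rec_nat init step (n - 1)" for n
  have T1: "T 1 = init" by (simp add: T_def)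
  have TS: "T (n + 1) = step (n - 1) (T n)" if n: "n \<ge> 1" for n
  proof -
    obtain k where "n = Suc k" using n by (cases n) auto
    then show ?thesis by (simp add: T_def)
  qed
  define a where "a n = fst (T n)" for n
  define b where "b n = fst (snd (T n))" for n
  define c where "c n = snd (snd (T n))" for n
  have S: "a (n + 1) = A n (a n) (b n) (c n)" "b (n + 1) = B n (a n) (b n) (c n)"
    "c (n + 1) = C n (a n) (b n) (c n)" if n: "n \<ge> 1" for n
    using n TS[OF n] by (simp_all add: a_def b_def c_def step_def split_beta)
  have I: "a 1 i j = (if i = 1 then exp (- (\<mu> + x) / \<sigma>) else 0)"
    "b 1 i j = (if i = 1 then 0 else exp ((\<mu> + x) / \<sigma>))" "c 1 = exp (- (\<mu> + x) / \<sigma>) / 2" for i j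
    by (simp_all only: a_def b_def c_def T1 init_def fst_conv snd_conv)
  have "lindley_coeffs \<mu> \<sigma> x a b c"
    unfolding lindley_coeffs_def
  proof (intro conjI allI impI ballI)
    fix n :: nat assume n: "n \<ge> 1"
    note S = S[OF n]
    show "c (n + 1) = exp (- \<mu> / \<sigma>) / (2 * (2 * \<sigma>) ^ n) *
         ((\<Sum>j = 1..n + 1. A2 \<mu> \<sigma> x n (a n) (b n) j) + (2 * \<sigma>) ^ n * c n)"
      unfolding S C_def ..
    fix i j :: nat
    assume "j \<in> {1..<min (n + 1) i}"
    then have j: "(j = 0) = False" by simp
    show "a (n + 1) i j = exp (- \<mu> / \<sigma>) *
             (\<Sum>k = j - 1..<min n (i - 1).
                (- 1) ^ (k + j) * a n (i - 1) k * (fact k / fact j) * (\<sigma> / 2) ^ (k + 1 - j))"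
      unfolding S A_def by (simp only: j if_False)
    show "b (n + 1) i j = exp (\<mu> / \<sigma>) *
             (\<Sum>k = j - 1..<min n (i - 1).
                b n (i - 1) k * (fact k / fact j) * (\<sigma> / 2) ^ (k + 1 - j))"
      unfolding S B_def by (simp only: j if_False)
  qed (simp_all only: I S A_def B_def if_True refl, simp_all)
  then show ?thesis by blast
qed

section \<open>The convolution recursion of the densities\<close>

definition lindley_density where
  "lindley_density \<mu> \<sigma> x a b n u = (\<Sum>i=1..n + 1. f_piece \<mu> \<sigma> x a b n i u)"

locale lindley_coefficients =
  fixes \<mu> \<sigma> x :: real and a b :: "nat \<Rightarrow> nat \<Rightarrow> nat \<Rightarrow> real" and c :: "nat \<Rightarrow> real"
  assumes mu: "0 \<le> \<mu>" and sigma: "0 < \<sigma>" and x: "0 < x"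
    and coeffs: "lindley_coeffs \<mu> \<sigma> x a b c"
begin

lemma coeffs_1:
  "c 1 = exp (- (\<mu> + x) / \<sigma>) / 2" "a 1 1 0 = exp (- (\<mu> + x) / \<sigma>)" "b 1 1 0 = 0"
  "a 1 2 0 = 0" "b 1 2 0 = exp ((\<mu> + x) / \<sigma>)"
  using coeffs unfolding lindley_coeffs_def by auto

text \<open>No growing exponential survives on the unbounded interval: all sums that define
  these coefficients involve only coefficients of the unbounded piece one level below, or Gamma
  values at infinity. This makes the densities integrable, and it makes the value 0 of a power
  at infinity harmless.\<close>
lemma a_unbounded_piece:
  assumes "1 \<le> n" "k < n" shows "a n (n + 1) k = 0"
  using assms
proof (induction n arbitrary: k rule: nat_induct_at_least)
  case base
  then show ?case using coeffs_1(4) by (simp add: numeral_2_eq_2)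
next
  case (Suc n)
  have IH: "a n (n + 1) k = 0" if "k < n" for k using Suc.IH that by simp
  have i: "n + 2 \<in> {1..n + 2}" by simp
  show ?case
  proof (cases "k = 0")
    case True
    have "a (n + 1) (n + 2) 0 = exp (- \<mu> / \<sigma>) *
           ((\<Sum>j = n + 2..n + 1. A2 \<mu> \<sigma> x n (a n) (b n) j)
            + (\<Sum>k<min n (n + 2 - 1).
                 a n (n + 2 - 1) k *
                   (pow_term \<mu> n k (rend \<mu> x n (n + 2 - 1)) + (- 1) ^ k * fact k * (\<sigma> / 2) ^ (k + 1))
                 - b n (n + 2 - 1) k * gam_minus \<mu> \<sigma> n k (rend \<mu> x n (n + 2 - 1)))
            + (2 * \<sigma>) ^ n * c n * (if n + 2 = 1 then 1 else 0))"
      using coeffs Suc.hyps i unfolding lindley_coeffs_def by blast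
    also have "\<dots> = 0"
      using IH by (simp add: rend_def gam_minus_infinity sigma)
    finally show ?thesis using True by simp
  next
    case False
    then have k: "k \<in> {1..<min (n + 1) (n + 2)}" using Suc.prems by auto
    have "a (n + 1) (n + 2) k = exp (- \<mu> / \<sigma>) *
             (\<Sum>j = k - 1..<min n (n + 2 - 1).
                (- 1) ^ (j + k) * a n (n + 2 - 1) j * (fact j / fact k) * (\<sigma> / 2) ^ (j + 1 - k))"
      using coeffs Suc.hyps i k unfolding lindley_coeffs_def by blast
    also have "\<dots> = 0" using IH by simp
    finally show ?thesis by simp
  qed
qed

lemma a_zero_if_infinite:
  assumes "1 \<le> n" "i \<le> n + 1" "rend \<mu> x n i = \<infinity>" shows "\<forall>k<min n i. a n i k = 0"
proof -
  have "i = n + 1" using assms by (simp add: rend_infinite_iff)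
  then show ?thesis using a_unbounded_piece[OF assms(1)] by auto
qed

lemma I_set_eq:
  "1 \<le> i \<Longrightarrow> I_set \<mu> x n i = {y. ereal (real_of_ereal (lend \<mu> x n i)) < ereal y \<and> ereal y \<le> rend \<mu> x n i}"
  by (simp add: I_set_def flip: lend_real)

lemma measurable_I_set [measurable]: "I_set \<mu> x n i \<in> sets borel"
  by (simp add: I_set_def)

lemma measurable_f_piece [measurable]: "f_piece \<mu> \<sigma> x a b n i \<in> borel_measurable borel"
  unfolding f_piece_eq_exp_poly[abs_def] by measurable

lemma measurable_lindley_density [measurable]: "lindley_density \<mu> \<sigma> x a b n \<in> borel_measurable borel"
  unfolding lindley_density_def[abs_def] by measurable

lemma integrable_f_piece:
  assumes "1 \<le> n" "i \<in> {1..n + 1}"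
  shows "integrable lborel (f_piece \<mu> \<sigma> x a b n i)"
proof -
  have "set_integrable lborel (I_set \<mu> x n i) (exp_poly \<sigma> (real n * \<mu>) (a n i) (b n i) (min n i))"
  proof -
    have i: "1 \<le> i" using assms by simp
    show ?thesis
      unfolding I_set_eq[OF i] using assms mu x
      by (intro set_integrable_exp_poly[OF sigma] a_zero_if_infinite)
        (auto intro: lend_le_rend simp flip: lend_real)
  qed
  then have "integrable lborel (\<lambda>u. (1 / (2 * \<sigma>) ^ n) * (indicator (I_set \<mu> x n i) u *\<^sub>R
      exp_poly \<sigma> (real n * \<mu>) (a n i) (b n i) (min n i) u))"
    unfolding set_integrable_def by (rule integrable_mult_right)
  then show ?thesis
    by (simp add: f_piece_eq_exp_poly[abs_def] mult.commute)
qed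

lemma integrable_lindley_density:
  "1 \<le> n \<Longrightarrow> integrable lborel (lindley_density \<mu> \<sigma> x a b n)"
  unfolding lindley_density_def[abs_def]
  by (intro Bochner_Integration.integrable_sum integrable_f_piece) auto

lemma lindley_density_nonpos: "1 \<le> n \<Longrightarrow> u \<le> 0 \<Longrightarrow> lindley_density \<mu> \<sigma> x a b n u = 0"
  using I_set_pos[OF mu x, of _ n u]
  by (force simp: lindley_density_def f_piece_eq_exp_poly indicator_def intro!: sum.neutral)

lemma lindley_density_on_I_set:
  assumes "1 \<le> n" "i \<in> {1..n + 1}" "u \<in> I_set \<mu> x n i"
  shows "lindley_density \<mu> \<sigma> x a b n u =
    exp_poly \<sigma> (real n * \<mu>) (a n i) (b n i) (min n i) u / (2 * \<sigma>) ^ n"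
proof -
  have "f_piece \<mu> \<sigma> x a b n j u = 0" if "j \<in> {1..n + 1} - {i}" for j
    using I_set_disjoint[OF mu x, of i j n u] I_set_disjoint[OF mu x, of j i n u] that assms
    by (auto simp: f_piece_eq_exp_poly indicator_def neq_iff)
  then have "lindley_density \<mu> \<sigma> x a b n u = (\<Sum>j\<in>{i}. f_piece \<mu> \<sigma> x a b n j u)"
    unfolding lindley_density_def using assms(2)
    by (intro sum.mono_neutral_right) auto
  then show ?thesis using assms by (simp add: f_piece_eq_exp_poly)
qed

definition piece_convolution :: "nat \<Rightarrow> nat \<Rightarrow> real \<Rightarrow> real" where
  "piece_convolution n j v = (LBINT y:I_set \<mu> x n j.
     exp_poly \<sigma> (real n * \<mu>) (a n j) (b n j) (min n j) y * exp (- \<bar>v - y\<bar> / \<sigma>))"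

lemma density_convolution:
  assumes "1 \<le> n"
  shows "(LBINT y. lindley_density \<mu> \<sigma> x a b n y * exp (- \<bar>v - y\<bar> / \<sigma>)) =
    (\<Sum>j=1..n + 1. piece_convolution n j v) / (2 * \<sigma>) ^ n"
proof -
  have "(LBINT y. lindley_density \<mu> \<sigma> x a b n y * exp (- \<bar>v - y\<bar> / \<sigma>)) =
      (LBINT y. \<Sum>j=1..n + 1. f_piece \<mu> \<sigma> x a b n j y * exp (- \<bar>v - y\<bar> / \<sigma>))"
    by (simp add: lindley_density_def sum_distrib_right del: sum.cl_ivl_Suc)
  also have "\<dots> = (\<Sum>j=1..n + 1. LBINT y. f_piece \<mu> \<sigma> x a b n j y * exp (- \<bar>v - y\<bar> / \<sigma>))"
  proof (rule Bochner_Integration.integral_sum)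
    fix j assume "j \<in> {1..n + 1}"
    then have "set_integrable lborel UNIV (f_piece \<mu> \<sigma> x a b n j)"
      using integrable_f_piece assms by (simp add: set_integrable_def)
    then have "set_integrable lborel UNIV (\<lambda>y. f_piece \<mu> \<sigma> x a b n j y * exp (- \<bar>v - y\<bar> / \<sigma>))"
      using sigma by (intro set_integrable_mult_bounded[where K=1]) auto
    then show "integrable lborel (\<lambda>y. f_piece \<mu> \<sigma> x a b n j y * exp (- \<bar>v - y\<bar> / \<sigma>))"
      by (simp add: set_integrable_def)
  qed
  also have "\<dots> = (\<Sum>j=1..n + 1. piece_convolution n j v / (2 * \<sigma>) ^ n)"
  proof (intro sum.cong refl)
    fix j
    have "(\<lambda>y. f_piece \<mu> \<sigma> x a b n j y * exp (- \<bar>v - y\<bar> / \<sigma>)) =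
        (\<lambda>y. (indicator (I_set \<mu> x n j) y *\<^sub>R
        (exp_poly \<sigma> (real n * \<mu>) (a n j) (b n j) (min n j) y * exp (- \<bar>v - y\<bar> / \<sigma>))) / (2 * \<sigma>) ^ n)"
      by (simp add: f_piece_eq_exp_poly fun_eq_iff mult_ac)
    then show "(LBINT y. f_piece \<mu> \<sigma> x a b n j y * exp (- \<bar>v - y\<bar> / \<sigma>)) = piece_convolution n j v / (2 * \<sigma>) ^ n"
      by (simp only: piece_convolution_def set_lebesgue_integral_def integral_divide_zero)
  qed
  finally show ?thesis by (simp only: sum_divide_distrib)
qed

lemma piece_convolution_right:
  assumes "1 \<le> n" "j \<in> {1..n + 1}" "ereal v \<le> lend \<mu> x n j"
  shows "piece_convolution n j v = exp (v / \<sigma>) * A2 \<mu> \<sigma> x n (a n) (b n) j"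
proof -
  let ?p = "real_of_ereal (lend \<mu> x n j)"
  have p: "lend \<mu> x n j = ereal ?p" by (rule lend_real)
  have pq: "ereal ?p \<le> rend \<mu> x n j" using lend_le_rend[of \<mu> x j n] mu x assms by (simp flip: p)
  have v: "v \<le> ?p" using assms(3) p by (metis ereal_less_eq(3))
  have j: "1 \<le> j" using assms by simp
  have "rend \<mu> x n j = \<infinity> \<Longrightarrow> \<forall>k<min n j. a n j k = 0"
    using assms by (intro a_zero_if_infinite) auto
  from convolution_above[OF sigma pq this v, of n \<mu> "b n j"] show ?thesis
    unfolding piece_convolution_def I_set_eq[OF j] A2_eq by (simp flip: p)
qed

lemma piece_convolution_left:
  assumes "1 \<le> n" "j \<in> {1..n}" "rend \<mu> x n j \<le> ereal v"
  shows "piece_convolution n j v = exp (- v / \<sigma>) * A1 \<mu> \<sigma> x n (a n) (b n) j"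
proof -
  let ?p = "real_of_ereal (lend \<mu> x n j)" and ?q = "real_of_ereal (rend \<mu> x n j)"
  have p: "lend \<mu> x n j = ereal ?p" by (rule lend_real)
  have q: "rend \<mu> x n j = ereal ?q" using assms by (simp add: rend_def)
  have pq: "?p \<le> ?q"
    using lend_le_rend[of \<mu> x j n] mu x assms p q by (metis atLeastAtMost_iff ereal_less_eq(3) less_imp_le trans_le_add1)
  have v: "?q \<le> v" using assms(3) q by (metis ereal_less_eq(3))
  have "I_set \<mu> x n j = {y. lend \<mu> x n j < ereal y \<and> ereal y \<le> rend \<mu> x n j}"
    using assms by (simp add: I_set_def)
  also have "\<dots> = {?p<..?q}" by (subst p, subst q) auto
  finally have I: "I_set \<mu> x n j = {?p<..?q}" .
  from convolution_below[OF sigma pq v, of n \<mu>] show ?thesis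
    unfolding piece_convolution_def I A1_eq by (simp flip: p q)
qed

lemma piece_convolution_inside:
  assumes "1 \<le> n" "j \<in> {1..n + 1}" "v \<in> I_set \<mu> x n j"
  shows "piece_convolution n j v =
    exp (v / \<sigma>) * (tilt_down_prim \<mu> \<sigma> n (a n j) (b n j) (min n j) (rend \<mu> x n j) -
                   tilt_down_prim \<mu> \<sigma> n (a n j) (b n j) (min n j) (ereal v)) +
    exp (- v / \<sigma>) * (tilt_up_prim \<mu> \<sigma> n (a n j) (b n j) (min n j) (ereal v) -
                     tilt_up_prim \<mu> \<sigma> n (a n j) (b n j) (min n j) (lend \<mu> x n j))"
proof -
  let ?p = "real_of_ereal (lend \<mu> x n j)"
  have p: "lend \<mu> x n j = ereal ?p" by (rule lend_real)
  have j: "1 \<le> j" using assms by simp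
  have v: "?p \<le> v" "ereal v \<le> rend \<mu> x n j" using assms(3) unfolding I_set_eq[OF j] by auto
  have "rend \<mu> x n j = \<infinity> \<Longrightarrow> \<forall>k<min n j. a n j k = 0"
    using assms by (intro a_zero_if_infinite) auto
  from convolution_inside[OF sigma v this, of n \<mu> "b n j"] show ?thesis
    unfolding piece_convolution_def I_set_eq[OF j] by (simp flip: p)
qed

text \<open>A point $v \le 0$ lies to the left of all pieces.\<close>
lemma density_convolution_nonpos:
  assumes "1 \<le> n" "v \<le> 0"
  shows "(LBINT y. lindley_density \<mu> \<sigma> x a b n y * exp (- \<bar>v - y\<bar> / \<sigma>)) =
    exp (v / \<sigma>) * (\<Sum>j=1..n + 1. A2 \<mu> \<sigma> x n (a n) (b n) j) / (2 * \<sigma>) ^ n"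
proof -
  have "piece_convolution n j v = exp (v / \<sigma>) * A2 \<mu> \<sigma> x n (a n) (b n) j" if "j \<in> {1..n + 1}" for j
  proof (rule piece_convolution_right[OF assms(1) that])
    have "ereal v \<le> 0" using assms(2) by simp
    also have "0 \<le> lend \<mu> x n j" using that assms(1) by (intro lend_nonneg mu x) auto
    finally show "ereal v \<le> lend \<mu> x n j" .
  qed
  then show ?thesis
    unfolding density_convolution[OF assms(1)] by (simp add: sum_distrib_left del: sum.cl_ivl_Suc)
qed

text \<open>When $v$ lies in the interval with index $i - 1$, the first bracket collects what
  the mass to the right of $v$ contributes to the convolution and the second what the mass to
  the left contributes; the atom at 0 counts as right of $v$ precisely if $i = 1$.\<close>
lemma coeffs_Suc:
  assumes "1 \<le> n" "i \<in> {1..n + 2}"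
  shows "exp_poly \<sigma> (real (n + 1) * \<mu>) (a (n + 1) i) (b (n + 1) i) (min (n + 1) i) (v + \<mu>) =
    exp (v / \<sigma>) * ((\<Sum>j=i..n + 1. A2 \<mu> \<sigma> x n (a n) (b n) j)
        + (tilt_down_prim \<mu> \<sigma> n (a n (i - 1)) (b n (i - 1)) (min n (i - 1)) (rend \<mu> x n (i - 1))
         - tilt_down_prim \<mu> \<sigma> n (a n (i - 1)) (b n (i - 1)) (min n (i - 1)) (ereal v))
        + (2 * \<sigma>) ^ n * c n * of_bool (i = 1)) +
    exp (- v / \<sigma>) * ((\<Sum>j=1..i - 2. A1 \<mu> \<sigma> x n (a n) (b n) j)
        + (tilt_up_prim \<mu> \<sigma> n (a n (i - 1)) (b n (i - 1)) (min n (i - 1)) (ereal v)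
         - tilt_up_prim \<mu> \<sigma> n (a n (i - 1)) (b n (i - 1)) (min n (i - 1)) (lend \<mu> x n (i - 1)))
        + (2 * \<sigma>) ^ n * c n * of_bool (i \<noteq> 1))"
proof -
  define m where "m = min n (i - 1)"
  define U where "U = (\<Sum>j=i..n + 1. A2 \<mu> \<sigma> x n (a n) (b n) j)
        + tilt_down_prim \<mu> \<sigma> n (a n (i - 1)) (b n (i - 1)) m (rend \<mu> x n (i - 1))
        + (2 * \<sigma>) ^ n * c n * of_bool (i = 1)"
  define L where "L = (\<Sum>j=1..i - 2. A1 \<mu> \<sigma> x n (a n) (b n) j)
        - tilt_up_prim \<mu> \<sigma> n (a n (i - 1)) (b n (i - 1)) m (lend \<mu> x n (i - 1))
        + (2 * \<sigma>) ^ n * c n * of_bool (i \<noteq> 1)"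
  have m: "min (n + 1) i = Suc m" using assms by (auto simp: m_def min_def)
  have "exp_poly \<sigma> (real (n + 1) * \<mu>) (a (n + 1) i) (b (n + 1) i) (Suc m) (v + \<mu>) =
    exp (v / \<sigma>) * (U - tilt_down_prim \<mu> \<sigma> n (a n (i - 1)) (b n (i - 1)) m (ereal v)) +
    exp (- v / \<sigma>) * (L + tilt_up_prim \<mu> \<sigma> n (a n (i - 1)) (b n (i - 1)) m (ereal v))"
  proof (rule exp_poly_recursion[OF sigma])
    show "a (n + 1) i j = exp (- \<mu> / \<sigma>) *
             (\<Sum>k = j - 1..<m. (- 1) ^ (k + j) * a n (i - 1) k * (fact k / fact j) * (\<sigma> / 2) ^ (k + 1 - j))"
      "b (n + 1) i j = exp (\<mu> / \<sigma>) *
             (\<Sum>k = j - 1..<m. b n (i - 1) k * (fact k / fact j) * (\<sigma> / 2) ^ (k + 1 - j))"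
      if "j \<in> {1..m}" for j
    proof -
      have "j \<in> {1..<min (n + 1) i}" using that m by auto
      then show "a (n + 1) i j = exp (- \<mu> / \<sigma>) *
             (\<Sum>k = j - 1..<m. (- 1) ^ (k + j) * a n (i - 1) k * (fact k / fact j) * (\<sigma> / 2) ^ (k + 1 - j))"
        "b (n + 1) i j = exp (\<mu> / \<sigma>) *
             (\<Sum>k = j - 1..<m. b n (i - 1) k * (fact k / fact j) * (\<sigma> / 2) ^ (k + 1 - j))"
        using coeffs assms unfolding lindley_coeffs_def m_def by blast+
    qed
    have "a (n + 1) i 0 = exp (- \<mu> / \<sigma>) *
           ((\<Sum>j = i..n + 1. A2 \<mu> \<sigma> x n (a n) (b n) j)
            + (\<Sum>k<m.
                 a n (i - 1) k *
                   (pow_term \<mu> n k (rend \<mu> x n (i - 1)) + (- 1) ^ k * fact k * (\<sigma> / 2) ^ (k + 1))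
                 - b n (i - 1) k * gam_minus \<mu> \<sigma> n k (rend \<mu> x n (i - 1)))
            + (2 * \<sigma>) ^ n * c n * (if i = 1 then 1 else 0))"
      using coeffs assms unfolding lindley_coeffs_def m_def by blast
    then show "a (n + 1) i 0 = exp (- \<mu> / \<sigma>) * (U + (\<Sum>k<m. a n (i - 1) k * ((- 1) ^ k * fact k * (\<sigma> / 2) ^ (k + 1))))"
      by (cases "i = 1") (simp_all add: U_def tilt_down_prim_def algebra_simps sum.distrib sum_subtractf del: sum.cl_ivl_Suc)
    have "b (n + 1) i 0 = exp (\<mu> / \<sigma>) *
           ((\<Sum>j = 1..i - 2. A1 \<mu> \<sigma> x n (a n) (b n) j)
            - (\<Sum>k<m.
                 b n (i - 1) k *
                   (pow_term \<mu> n k (lend \<mu> x n (i - 1)) - fact k * (\<sigma> / 2) ^ (k + 1))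
                 + a n (i - 1) k * gam_plus \<mu> \<sigma> n k (lend \<mu> x n (i - 1)))
            + (2 * \<sigma>) ^ n * c n * (1 - (if i = 1 then 1 else 0)))"
      using coeffs assms unfolding lindley_coeffs_def m_def by blast
    then show "b (n + 1) i 0 = exp (\<mu> / \<sigma>) * (L + (\<Sum>k<m. b n (i - 1) k * (fact k * (\<sigma> / 2) ^ (k + 1))))"
      by (cases "i = 1") (simp_all add: L_def tilt_up_prim_def algebra_simps sum.distrib sum_subtractf del: sum.cl_ivl_Suc)
  qed
  moreover have "U - tilt_down_prim \<mu> \<sigma> n (a n (i - 1)) (b n (i - 1)) m (ereal v) =
      (\<Sum>j=i..n + 1. A2 \<mu> \<sigma> x n (a n) (b n) j)
        + (tilt_down_prim \<mu> \<sigma> n (a n (i - 1)) (b n (i - 1)) m (rend \<mu> x n (i - 1))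
         - tilt_down_prim \<mu> \<sigma> n (a n (i - 1)) (b n (i - 1)) m (ereal v))
        + (2 * \<sigma>) ^ n * c n * of_bool (i = 1)"
    unfolding U_def by linarith
  moreover have "L + tilt_up_prim \<mu> \<sigma> n (a n (i - 1)) (b n (i - 1)) m (ereal v) =
      (\<Sum>j=1..i - 2. A1 \<mu> \<sigma> x n (a n) (b n) j)
        + (tilt_up_prim \<mu> \<sigma> n (a n (i - 1)) (b n (i - 1)) m (ereal v)
         - tilt_up_prim \<mu> \<sigma> n (a n (i - 1)) (b n (i - 1)) m (lend \<mu> x n (i - 1)))
        + (2 * \<sigma>) ^ n * c n * of_bool (i \<noteq> 1)"
    unfolding L_def by linarith
  ultimately show ?thesis by (simp only: m m_def[symmetric])
qed

text \<open>The convolution recursion for the densities. With $v = u - \mu$, pieces to the right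
  of $v$ contribute $A^{(2)}$, pieces to the left $A^{(1)}$, and the piece that contains $v$ is
  split at $v$.\<close>
lemma lindley_density_Suc:
  assumes "1 \<le> n" "0 < u"
  shows "2 * \<sigma> * lindley_density \<mu> \<sigma> x a b (n + 1) u =
    c n * exp (- \<bar>u - \<mu>\<bar> / \<sigma>) + (LBINT y. lindley_density \<mu> \<sigma> x a b n y * exp (- \<bar>u - \<mu> - y\<bar> / \<sigma>))"
proof -
  let ?v = "u - \<mu>"
  have n1: "1 \<le> n + 1" by simp
  from I_set_cover_pos[OF mu x n1 assms(2)] obtain i where
    i: "i \<in> {1..n + 2}" and u: "u \<in> I_set \<mu> x (n + 1) i" by auto
  have i': "i \<in> {1..n + 1 + 1}" using i by simp
  have lhs: "2 * \<sigma> * lindley_density \<mu> \<sigma> x a b (n + 1) u =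
      exp_poly \<sigma> (real (n + 1) * \<mu>) (a (n + 1) i) (b (n + 1) i) (min (n + 1) i) (?v + \<mu>) / (2 * \<sigma>) ^ n"
    unfolding lindley_density_on_I_set[OF n1 i' u] using sigma by simp
  show ?thesis
  proof (cases "i = 1")
    case True
    then have "?v \<le> 0" using u assms by (auto simp: I_set_def rend_def)
    have atom: "exp (?v / \<sigma>) * (S + (2 * \<sigma>) ^ n * c n) / (2 * \<sigma>) ^ n =
        c n * exp (- \<bar>?v\<bar> / \<sigma>) + exp (?v / \<sigma>) * S / (2 * \<sigma>) ^ n" for S
      using \<open>?v \<le> 0\<close> sigma by (simp add: distrib_left add_divide_distrib)
    then show ?thesis
      unfolding lhs coeffs_Suc[OF assms(1) i] density_convolution_nonpos[OF assms(1) \<open>?v \<le> 0\<close>]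
      by (simp add: True tilt_down_prim_def tilt_up_prim_def atom del: sum.cl_ivl_Suc)
  next
    case False
    then have j: "i - 1 \<in> {1..n + 1}" "1 \<le> i - 1" "i - 1 + 1 = i" using i by auto
    then have v: "?v \<in> I_set \<mu> x n (i - 1)" using u I_set_Suc_shift[OF j(2), of u \<mu> x n] by simp
    then have "0 < ?v" by (rule I_set_pos[OF mu x j(2) assms(1)])
    have vr: "ereal ?v \<le> rend \<mu> x n (i - 1)" and vl: "lend \<mu> x n (i - 1) \<le> ereal ?v"
      using v j by (auto simp: I_set_def)
    have R: "piece_convolution n j ?v = exp (?v / \<sigma>) * A2 \<mu> \<sigma> x n (a n) (b n) j" if "j \<in> {i..n + 1}" for j
      using that i j mu x assms(1)
      by (intro piece_convolution_right order_trans[OF vr rend_le_lend]) auto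
    have Lf: "piece_convolution n j ?v = exp (- ?v / \<sigma>) * A1 \<mu> \<sigma> x n (a n) (b n) j" if "j \<in> {1..i - 2}" for j
      using that i j mu x assms(1)
      by (intro piece_convolution_left order_trans[OF rend_le_lend vl]) auto
    \<comment> \<open>Pieces to the left of \<open>u - \<mu>\<close>, the piece that contains it, and pieces to the right.\<close>
    have split: "{1..n + 1} = {1..i - 2} \<union> insert (i - 1) {i..n + 1}" using j by auto
    have "(\<Sum>j=1..n + 1. piece_convolution n j ?v) =
        (\<Sum>j=1..i - 2. piece_convolution n j ?v) + (piece_convolution n (i - 1) ?v + (\<Sum>j=i..n + 1. piece_convolution n j ?v))"
    proof -
      have "{1..i - 2} \<inter> insert (i - 1) {i..n + 1} = {}" "i - 1 \<notin> {i..n + 1}" using j by auto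
      then show ?thesis unfolding split by (simp add: sum.union_disjoint del: sum.cl_ivl_Suc)
    qed
    also have "\<dots> = exp (- ?v / \<sigma>) * (\<Sum>j=1..i - 2. A1 \<mu> \<sigma> x n (a n) (b n) j) +
      (piece_convolution n (i - 1) ?v + exp (?v / \<sigma>) * (\<Sum>j=i..n + 1. A2 \<mu> \<sigma> x n (a n) (b n) j))"
      using R Lf by (simp add: sum_distrib_left del: sum.cl_ivl_Suc)
    finally have sum: "(\<Sum>j=1..n + 1. piece_convolution n j ?v) = \<dots>" .
    have abs: "\<bar>?v\<bar> = ?v" using \<open>0 < ?v\<close> by simp
    have rearrange: "(E * (S2 + D + K * C * of_bool (i = 1)) + F * (S1 + G + K * C * of_bool (i \<noteq> 1))) / K =
        C * F + (F * S1 + (E * D + F * G + E * S2)) / K" if "K \<noteq> 0" for E F S1 S2 D G K C :: real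
      using that False by (simp add: field_simps)
    show ?thesis
      unfolding lhs coeffs_Suc[OF assms(1) i] density_convolution[OF assms(1)] sum
        piece_convolution_inside[OF assms(1) j(1) v] abs
      by (rule rearrange) (use sigma in simp)
  qed
qed

lemma c_Suc:
  assumes "1 \<le> n"
  shows "2 * c (n + 1) =
    exp (- \<mu> / \<sigma>) * (c n + (LBINT y. lindley_density \<mu> \<sigma> x a b n y * exp (- \<bar>0 - y\<bar> / \<sigma>)))"
proof -
  have "c (n + 1) = exp (- \<mu> / \<sigma>) / (2 * (2 * \<sigma>) ^ n) *
         ((\<Sum>j = 1..n + 1. A2 \<mu> \<sigma> x n (a n) (b n) j) + (2 * \<sigma>) ^ n * c n)"
    using coeffs assms unfolding lindley_coeffs_def by blast
  then show ?thesis
    unfolding density_convolution_nonpos[OF assms order_refl] using sigma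
    by (simp add: field_simps del: sum.cl_ivl_Suc)
qed

lemma lindley_density_1:
  assumes "0 < u"
  shows "2 * \<sigma> * lindley_density \<mu> \<sigma> x a b 1 u = exp (- \<bar>u - x - \<mu>\<bar> / \<sigma>)"
proof (cases "u \<le> \<mu> + x")
  case True
  then have u: "u \<in> I_set \<mu> x 1 1" using assms by (simp add: I_set_def lend_def rend_def zero_ereal_def)
  have "exp (- \<bar>u - x - \<mu>\<bar> / \<sigma>) = exp (- (\<mu> + x) / \<sigma>) * exp (u / \<sigma>)"
    using True by (simp add: exp_add[symmetric] add_divide_distrib diff_divide_distrib)
  then show ?thesis
    using lindley_density_on_I_set[OF _ _ u] sigma coeffs_1 by (simp add: exp_poly_def)
next
  case False
  then have u: "u \<in> I_set \<mu> x 1 2" by (simp add: I_set_def lend_def rend_def)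
  have "exp (- \<bar>u - x - \<mu>\<bar> / \<sigma>) = exp ((\<mu> + x) / \<sigma>) * exp (- u / \<sigma>)"
    using False by (simp add: exp_add[symmetric] add_divide_distrib diff_divide_distrib)
  then show ?thesis
    using lindley_density_on_I_set[OF _ _ u] sigma coeffs_1 by (simp add: exp_poly_def)
qed

end

section \<open>Test functions and distributional derivatives\<close>

lemma test_function_DERIV:
  "test_function \<phi> \<Longrightarrow> (\<phi> has_real_derivative deriv \<phi> y) (at y)"
  unfolding test_function_def by (metis field_differentiable_derivI funpow_0)

lemma test_function_continuous: "test_function \<phi> \<Longrightarrow> continuous_on S \<phi>"
  by (meson DERIV_continuous_on DERIV_subset subset_UNIV test_function_DERIV)

lemma test_function_continuous_deriv:
  assumes "test_function \<phi>" shows "continuous_on S (deriv \<phi>)"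
proof -
  have "deriv \<phi> field_differentiable at y" for y
    using assms unfolding test_function_def by (metis One_nat_def funpow.simps(2) funpow_0 comp_apply)
  then show ?thesis
    by (meson continuous_at_imp_continuous_on field_differentiable_imp_continuous_at)
qed

lemma test_function_deriv_outside:
  assumes "test_function \<phi>" "y \<notin> closure {y. \<phi> y \<noteq> 0}"
  shows "deriv \<phi> y = 0"
proof -
  have "((\<lambda>_. 0) has_real_derivative deriv \<phi> y) (at y)"
  proof (rule has_field_derivative_transform_within_open[OF test_function_DERIV[OF assms(1)]])
    show "open (- closure {y. \<phi> y \<noteq> 0})" by auto
    show "\<phi> z = 0" if "z \<in> - closure {y. \<phi> y \<noteq> 0}" for z
      using that closure_subset[of "{y. \<phi> y \<noteq> 0}"] by auto
  qed (use assms in auto)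
  then show ?thesis using DERIV_unique DERIV_const by blast
qed

lemma test_function_bounded:
  assumes "test_function \<phi>" obtains K where "\<And>y. \<bar>\<phi> y\<bar> \<le> K"
proof -
  let ?S = "closure {y. \<phi> y \<noteq> 0}"
  have "compact (\<phi> ` ?S)"
    using assms by (intro compact_continuous_image test_function_continuous) (auto simp: test_function_def)
  then obtain K where K: "\<And>y. y \<in> ?S \<Longrightarrow> \<bar>\<phi> y\<bar> \<le> K"
    by (metis bounded_iff compact_imp_bounded image_eqI real_norm_def)
  have "\<bar>\<phi> y\<bar> \<le> max K 0" for y
    using K[of y] closure_subset[of "{y. \<phi> y \<noteq> 0}"] by (cases "\<phi> y = 0") auto
  then show ?thesis by (rule that)
qed

lemma test_function_integrable_deriv:
  assumes "test_function \<phi>" shows "integrable lborel (deriv \<phi>)"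
proof -
  let ?S = "closure {y. \<phi> y \<noteq> 0}"
  have "integrable lborel (\<lambda>y. indicator ?S y *\<^sub>R deriv \<phi> y)"
    using assms by (intro borel_integrable_compact test_function_continuous_deriv) (auto simp: test_function_def)
  moreover have "(\<lambda>y. indicator ?S y *\<^sub>R deriv \<phi> y) = deriv \<phi>"
    using test_function_deriv_outside[OF assms] by (auto simp: fun_eq_iff indicator_def)
  ultimately show ?thesis by simp
qed

lemma test_function_at_top:
  assumes "test_function \<phi>" shows "(\<phi> \<longlongrightarrow> 0) at_top"
proof -
  have "bounded (closure {y. \<phi> y \<noteq> 0})"
    using assms by (auto simp: test_function_def compact_imp_bounded)
  then obtain B where B: "\<And>y. y \<in> closure {y. \<phi> y \<noteq> 0} \<Longrightarrow> \<bar>y\<bar> \<le> B"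
    by (auto simp: bounded_iff)
  have "\<phi> y = 0" if "B < y" for y
    using B[of y] that closure_subset[of "{y. \<phi> y \<noteq> 0}"] by auto
  then show ?thesis
    by (intro tendsto_eventually eventually_at_top_dense[THEN iffD2]) auto
qed

lemma test_function_integral_deriv:
  assumes "test_function \<phi>" shows "(LBINT u:{w..}. deriv \<phi> u) = - \<phi> w"
proof -
  have "set_integrable lborel {w..} (deriv \<phi>)"
    using test_function_integrable_deriv[OF assms] unfolding set_integrable_def
    by (intro integrable_mult_indicator) auto
  then have "(LBINT u:{w..}. deriv \<phi> u) = 0 - \<phi> w"
    by (intro set_integral_Ici_FTC test_function_DERIV test_function_continuous_deriv test_function_at_top assms)
  then show ?thesis by simp
qed

text \<open>By Fubini, integrating the distribution function against $\phi'$ is the expectation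
  of the integral of $\phi'$ over $[X, \infty)$, which is $- \phi(X)$. The distributional
  density therefore acts on test functions as the law of $X$.\<close>
lemma (in prob_space) distributional_deriv_of_cdf:
  assumes X[measurable]: "X \<in> borel_measurable M"
    and T: "\<And>\<phi>. test_function \<phi> \<Longrightarrow> T \<phi> = expectation (\<lambda>\<omega>. \<phi> (X \<omega>))"
  shows "has_gf_density M X T"
  unfolding has_gf_density_def is_distributional_deriv_def
proof (intro conjI allI impI X)
  fix \<phi> assume \<phi>: "test_function \<phi>"
  interpret pair_sigma_finite M lborel ..
  have [measurable]: "deriv \<phi> \<in> borel_measurable borel"
    by (intro borel_measurable_continuous_onI test_function_continuous_deriv \<phi>)
  note int = test_function_integrable_deriv[OF \<phi>]
  let ?h = "\<lambda>\<omega> u. indicator {X \<omega>..} u * deriv \<phi> u"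
  have h: "?h \<omega> u = (if X \<omega> \<le> u then deriv \<phi> u else 0)" for \<omega> u by simp
  have inth: "integrable lborel (?h \<omega>)" for \<omega>
    using integrable_mult_indicator[OF _ int, of "{X \<omega>..}"] by simp
  have "integrable (M \<Otimes>\<^sub>M lborel) (case_prod ?h)"
  proof (rule Fubini_integrable)
    show "case_prod ?h \<in> borel_measurable (M \<Otimes>\<^sub>M lborel)"
      unfolding h by measurable
    show "integrable M (\<lambda>\<omega>. LBINT u. norm (case_prod ?h (\<omega>, u)))"
    proof (rule integrable_const_bound[of _ "LBINT u. norm (deriv \<phi> u)"])
      show "AE \<omega> in M. norm (LBINT u. norm (case_prod ?h (\<omega>, u))) \<le> (LBINT u. norm (deriv \<phi> u))"
      proof (intro AE_I2)
        fix \<omega>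
        have "(LBINT u. norm (?h \<omega> u)) \<le> (LBINT u. norm (deriv \<phi> u))"
          using int inth by (intro integral_mono integrable_norm) (auto simp: indicator_def)
        then show "norm (LBINT u. norm (case_prod ?h (\<omega>, u))) \<le> (LBINT u. norm (deriv \<phi> u))"
          by simp
      qed
      show "(\<lambda>\<omega>. LBINT u. norm (case_prod ?h (\<omega>, u))) \<in> borel_measurable M"
        unfolding split_conv h by measurable
    qed
    show "AE \<omega> in M. integrable lborel (\<lambda>u. case_prod ?h (\<omega>, u))"
      using inth by simp
  qed
  then have "(LBINT u. expectation (\<lambda>\<omega>. ?h \<omega> u)) = expectation (\<lambda>\<omega>. LBINT u. ?h \<omega> u)"
    by (rule Fubini_integral)
  also have "(\<lambda>\<omega>. LBINT u. ?h \<omega> u) = (\<lambda>\<omega>. - \<phi> (X \<omega>))"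
    using test_function_integral_deriv[OF \<phi>] by (simp add: set_lebesgue_integral_def)
  also have "(\<lambda>u. expectation (\<lambda>\<omega>. ?h \<omega> u)) = (\<lambda>u. measure M {\<omega> \<in> space M. X \<omega> \<le> u} * deriv \<phi> u)"
  proof
    fix u
    have "expectation (\<lambda>\<omega>. ?h \<omega> u) = expectation (\<lambda>\<omega>. indicator {\<omega> \<in> space M. X \<omega> \<le> u} \<omega> * deriv \<phi> u)"
      by (intro Bochner_Integration.integral_cong) (auto simp: indicator_def)
    then show "expectation (\<lambda>\<omega>. ?h \<omega> u) = measure M {\<omega> \<in> space M. X \<omega> \<le> u} * deriv \<phi> u"
      by simp
  qed
  finally show "T \<phi> = - (LBINT u. measure M {\<omega> \<in> space M. X \<omega> \<le> u} * deriv \<phi> u)"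
    using T[OF \<phi>] by simp
qed

section \<open>The Lindley process with Laplace increments\<close>

lemma measurable_laplace_density [measurable]: "laplace_density \<mu> \<sigma> \<in> borel_measurable borel"
  unfolding laplace_density_def[abs_def] by measurable

lemma laplace_density_nonneg: "0 < \<sigma> \<Longrightarrow> 0 \<le> laplace_density \<mu> \<sigma> z"
  by (simp add: laplace_density_def)

text \<open>The sign conditions place the threshold $-w$ at or to the left of the mode $\mu$,
  where the density is a single exponential.\<close>
lemma laplace_lower_tail:
  assumes "0 < \<sigma>" "0 \<le> \<mu>" "0 \<le> w"
  shows "(LBINT z:{..-w}. laplace_density \<mu> \<sigma> z) = exp (- (w + \<mu>) / \<sigma>) / 2"
proof -
  let ?f = "\<lambda>z. exp (- (z + \<mu>) / \<sigma>) / (2 * \<sigma>)"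
  have "(LBINT z:{..-w}. laplace_density \<mu> \<sigma> z) = (LBINT z:{w..}. ?f z)"
    unfolding set_lebesgue_integral_def
    using assms by (subst lborel_integral_real_affine[where c="- 1" and t=0])
      (auto simp: laplace_density_def indicator_def add_divide_distrib diff_divide_distrib
        intro!: Bochner_Integration.integral_cong)
  also have "\<dots> = 0 - (- exp (- (w + \<mu>) / \<sigma>) / 2)"
  proof (rule set_integral_Ici_FTC)
    show "((\<lambda>z. - exp (- (z + \<mu>) / \<sigma>) / 2) has_real_derivative ?f z) (at z)" for z
      using assms by (auto intro!: derivative_eq_intros simp: field_simps)
    show "continuous_on UNIV ?f" using assms by (intro continuous_intros) auto
    have "set_integrable lborel {w..} (\<lambda>z. exp (- \<mu> / \<sigma>) / (2 * \<sigma>) * ((z - 0) ^ 0 * exp (- (1 / \<sigma>) * z)))"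
      using assms by (intro set_integrable_mult_right set_integrable_shifted_power_exp) auto
    moreover have "(\<lambda>z. exp (- \<mu> / \<sigma>) / (2 * \<sigma>) * ((z - 0) ^ 0 * exp (- (1 / \<sigma>) * z))) = ?f"
      by (simp add: fun_eq_iff exp_add[symmetric] add_divide_distrib diff_divide_distrib)
    ultimately show "set_integrable lborel {w..} ?f" by simp
    have "filterlim (\<lambda>z. (- (1 / \<sigma>)) * (\<mu> + z)) at_bot at_top"
      using assms
      by (intro filterlim_tendsto_neg_mult_at_bot[OF tendsto_const]
          filterlim_tendsto_add_at_top[OF tendsto_const filterlim_ident]) auto
    then have "((\<lambda>z. exp ((- (1 / \<sigma>)) * (\<mu> + z))) \<longlongrightarrow> 0) at_top"
      by (rule filterlim_compose[OF exp_at_bot])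
    then have "((\<lambda>z. - exp ((- (1 / \<sigma>)) * (\<mu> + z)) / 2) \<longlongrightarrow> - 0 / 2) at_top"
      by (intro tendsto_intros) auto
    moreover have "(\<lambda>z. - exp ((- (1 / \<sigma>)) * (\<mu> + z)) / 2) = (\<lambda>z. - exp (- (z + \<mu>) / \<sigma>) / 2)"
      by (simp add: fun_eq_iff add_divide_distrib diff_divide_distrib)
    ultimately show "((\<lambda>z. - exp (- (z + \<mu>) / \<sigma>) / 2) \<longlongrightarrow> 0) at_top"
      by simp
  qed
  finally show ?thesis by simp
qed

lemma lindley_measurable:
  "(\<And>k. k \<in> {1..n} \<Longrightarrow> Z k \<in> borel_measurable N) \<Longrightarrow> lindley x Z n \<in> borel_measurable N"
  by (induction n) auto

lemma lindley_cong:
  "(\<And>k. k \<in> {1..n} \<Longrightarrow> Z k \<omega> = Z' k \<omega>') \<Longrightarrow> lindley x Z n \<omega> = lindley x Z' n \<omega>'"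
  by (induction n) auto

lemma lindley_nonneg: "0 \<le> x \<Longrightarrow> 0 \<le> lindley x Z n \<omega>"
  by (cases n) auto

text \<open>The value at time $n$ is a measurable function of the increments up to $n$ alone: it
  is the same recursion run on the coordinates of the restricted family.\<close>
lemma (in prob_space) indep_var_lindley:
  assumes ind: "indep_vars (\<lambda>_. borel) Z {1..}"
  shows "indep_var borel (lindley x Z n) borel (Z (Suc n))"
proof -
  let ?P = "PiM {1..n} (\<lambda>_. borel :: real measure)" and ?Q = "PiM {Suc n} (\<lambda>_. borel :: real measure)"
  have "indep_var ?P (\<lambda>\<omega>. restrict (\<lambda>i. Z i \<omega>) {1..n}) ?Q (\<lambda>\<omega>. restrict (\<lambda>i. Z i \<omega>) {Suc n})"
    by (rule indep_var_restrict[OF ind]) auto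
  then have "indep_var borel (lindley x (\<lambda>k w. w k) n \<circ> (\<lambda>\<omega>. restrict (\<lambda>i. Z i \<omega>) {1..n}))
      borel ((\<lambda>w. w (Suc n)) \<circ> (\<lambda>\<omega>. restrict (\<lambda>i. Z i \<omega>) {Suc n}))"
    by (rule indep_var_compose) (intro lindley_measurable measurable_component_singleton; simp)+
  moreover have "lindley x (\<lambda>k w. w k) n \<circ> (\<lambda>\<omega>. restrict (\<lambda>i. Z i \<omega>) {1..n}) = lindley x Z n"
    by (auto simp: fun_eq_iff intro!: lindley_cong)
  moreover have "(\<lambda>w. w (Suc n)) \<circ> (\<lambda>\<omega>. restrict (\<lambda>i. Z i \<omega>) {Suc n}) = Z (Suc n)"
    by auto
  ultimately show ?thesis by simp
qed

text \<open>The transition operator of the Lindley process: the expectation of $\phi$ after one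
  step from $w$.\<close>
definition reflected_step :: "real \<Rightarrow> real \<Rightarrow> (real \<Rightarrow> real) \<Rightarrow> real \<Rightarrow> real" where
  "reflected_step \<mu> \<sigma> \<phi> w = (LBINT z. laplace_density \<mu> \<sigma> z * \<phi> (max 0 (w + z)))"

locale laplace_lindley = prob_space M for M :: "'a measure" +
  fixes Z :: "nat \<Rightarrow> 'a \<Rightarrow> real" and \<mu> \<sigma> x :: real
  assumes mu: "0 \<le> \<mu>" and sigma: "0 < \<sigma>" and x: "0 < x"
    and indep: "indep_vars (\<lambda>_. borel) Z {1..}"
    and laplace: "\<And>k. k \<ge> 1 \<Longrightarrow> distributed M lborel (Z k) (\<lambda>z. ennreal (laplace_density \<mu> \<sigma> z))"
begin

lemma measurable_Z: "k \<ge> 1 \<Longrightarrow> Z k \<in> borel_measurable M"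
  using distributed_measurable[OF laplace] by simp

lemma measurable_lindley [measurable]: "lindley x Z n \<in> borel_measurable M"
  by (intro lindley_measurable measurable_Z) auto

lemma laplace_integrable: "integrable lborel (laplace_density \<mu> \<sigma>)"
  using distributed_integrable[OF laplace[of 1], of "\<lambda>_. 1"] laplace_density_nonneg[OF sigma] by simp

lemma laplace_integral: "(LBINT z. laplace_density \<mu> \<sigma> z) = 1"
  using distributed_integral[OF laplace[of 1], of "\<lambda>_. 1"] laplace_density_nonneg[OF sigma]
  by (simp add: prob_space)

lemma laplace_mult_integrable:
  assumes [measurable]: "\<phi> \<in> borel_measurable borel" and "\<And>y. \<bar>\<phi> y\<bar> \<le> K"
  shows "integrable lborel (\<lambda>z. laplace_density \<mu> \<sigma> z * \<phi> z)"
  using set_integrable_mult_bounded[of UNIV "laplace_density \<mu> \<sigma>" \<phi> K] laplace_integrable assms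
  by (simp add: set_integrable_def)

lemma measurable_reflected_step [measurable]:
  assumes [measurable]: "\<phi> \<in> borel_measurable borel"
  shows "reflected_step \<mu> \<sigma> \<phi> \<in> borel_measurable borel"
  unfolding reflected_step_def[abs_def] by measurable

lemma reflected_step_bounded:
  assumes [measurable]: "\<phi> \<in> borel_measurable borel" and "\<And>y. \<bar>\<phi> y\<bar> \<le> K"
  shows "\<bar>reflected_step \<mu> \<sigma> \<phi> w\<bar> \<le> K"
proof -
  have K: "0 \<le> K" using assms(2)[of 0] by simp
  have "\<bar>reflected_step \<mu> \<sigma> \<phi> w\<bar> \<le> (LBINT z. \<bar>laplace_density \<mu> \<sigma> z * \<phi> (max 0 (w + z))\<bar>)"
    unfolding reflected_step_def by (rule integral_abs_bound)
  also have "\<dots> \<le> (LBINT z. laplace_density \<mu> \<sigma> z * K)"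
  proof (rule integral_mono)
    show "integrable lborel (\<lambda>z. \<bar>laplace_density \<mu> \<sigma> z * \<phi> (max 0 (w + z))\<bar>)"
      using assms(2) by (intro integrable_abs laplace_mult_integrable[of "\<lambda>z. \<phi> (max 0 (w + z))" K]) auto
    show "\<bar>laplace_density \<mu> \<sigma> z * \<phi> (max 0 (w + z))\<bar> \<le> laplace_density \<mu> \<sigma> z * K" for z
      using laplace_density_nonneg[OF sigma] assms(2) by (auto simp: abs_mult intro!: mult_left_mono)
  qed (use laplace_integrable in simp)
  also have "\<dots> = K" using laplace_integral by simp
  finally show ?thesis .
qed

text \<open>By independence the joint law of the present value and the next increment is a
  product, so the increment can be integrated out first.\<close>
lemma expectation_lindley_Suc:
  assumes [measurable]: "\<phi> \<in> borel_measurable borel" and "\<And>y. \<bar>\<phi> y\<bar> \<le> K"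
  shows "expectation (\<lambda>\<omega>. \<phi> (lindley x Z (Suc n) \<omega>)) = expectation (\<lambda>\<omega>. reflected_step \<mu> \<sigma> \<phi> (lindley x Z n \<omega>))"
proof -
  let ?W = "lindley x Z n" and ?Z = "Z (Suc n)"
  let ?D = "distr M borel ?W" and ?L = "distr M borel ?Z"
  have [measurable]: "?Z \<in> borel_measurable M" by (rule measurable_Z) simp
  interpret D: prob_space ?D by (rule prob_space_distr) measurable
  interpret L: prob_space ?L by (rule prob_space_distr) measurable
  interpret DL: pair_prob_space ?D ?L ..
  have joint: "?D \<Otimes>\<^sub>M ?L = distr M (borel \<Otimes>\<^sub>M borel) (\<lambda>\<omega>. (?W \<omega>, ?Z \<omega>))"
    using indep_var_lindley[OF indep, of x n] by (simp add: indep_var_distribution_eq)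
  let ?h = "\<lambda>p. \<phi> (max 0 (fst p + snd p))"
  have inner: "(\<integral>z. ?h (w, z) \<partial>?L) = reflected_step \<mu> \<sigma> \<phi> w" for w
  proof -
    have "(\<integral>z. ?h (w, z) \<partial>?L) = expectation (\<lambda>\<omega>. \<phi> (max 0 (w + ?Z \<omega>)))"
      by (subst integral_distr) auto
    also have "\<dots> = reflected_step \<mu> \<sigma> \<phi> w"
      unfolding reflected_step_def
      by (rule distributed_integral[OF laplace, symmetric]) (auto simp: laplace_density_nonneg sigma)
    finally show ?thesis .
  qed
  have "expectation (\<lambda>\<omega>. \<phi> (lindley x Z (Suc n) \<omega>)) = expectation (\<lambda>\<omega>. ?h (?W \<omega>, ?Z \<omega>))"
    by simp
  also have "\<dots> = (\<integral>p. ?h p \<partial>distr M (borel \<Otimes>\<^sub>M borel) (\<lambda>\<omega>. (?W \<omega>, ?Z \<omega>)))"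
    by (rule integral_distr[symmetric]) measurable
  also have "\<dots> = (\<integral>p. ?h p \<partial>(?D \<Otimes>\<^sub>M ?L))"
    by (simp only: joint)
  also have "\<dots> = (\<integral>w. (\<integral>z. ?h (w, z) \<partial>?L) \<partial>?D)"
  proof (rule DL.integral_fst'[symmetric])
    show "integrable (?D \<Otimes>\<^sub>M ?L) ?h"
      using assms(2) by (intro DL.P.integrable_const_bound[of _ K]) auto
  qed
  also have "\<dots> = expectation (\<lambda>\<omega>. reflected_step \<mu> \<sigma> \<phi> (?W \<omega>))"
    unfolding inner by (rule integral_distr) measurable
  finally show ?thesis .
qed

text \<open>The step is reflected to 0 if the increment is at most $-w$; this event carries the
  atom. Otherwise the new position $u = w + z$ is positive.\<close>
lemma reflected_step_eq:
  assumes [measurable]: "\<phi> \<in> borel_measurable borel" and bound: "\<And>y. \<bar>\<phi> y\<bar> \<le> K" and w: "0 \<le> w"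
  shows "reflected_step \<mu> \<sigma> \<phi> w = \<phi> 0 * (exp (- (w + \<mu>) / \<sigma>) / 2) +
    (LBINT u:{0<..}. laplace_density \<mu> \<sigma> (u - w) * \<phi> u)"
proof -
  let ?f = "\<lambda>z. indicator {..-w} z * laplace_density \<mu> \<sigma> z * \<phi> 0"
  let ?g = "\<lambda>z. indicator {-w<..} z * (laplace_density \<mu> \<sigma> z * \<phi> (w + z))"
  have f: "integrable lborel ?f"
    using integrable_mult_indicator[OF _ laplace_integrable, of "{..-w}"] by simp
  have "integrable lborel (\<lambda>z. laplace_density \<mu> \<sigma> z * \<phi> (w + z))"
    using bound by (intro laplace_mult_integrable[of "\<lambda>z. \<phi> (w + z)" K]) auto
  from integrable_mult_indicator[OF _ this, of "{-w<..}"] have g: "integrable lborel ?g" by simp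
  have "reflected_step \<mu> \<sigma> \<phi> w = (LBINT z. ?f z + ?g z)"
    unfolding reflected_step_def by (intro Bochner_Integration.integral_cong) (auto simp: indicator_def)
  also have "\<dots> = (LBINT z. ?f z) + (LBINT z. ?g z)"
    using f g by (rule Bochner_Integration.integral_add)
  also have "(LBINT z. ?f z) = \<phi> 0 * (exp (- (w + \<mu>) / \<sigma>) / 2)"
    using laplace_lower_tail[OF sigma mu w] by (simp add: set_lebesgue_integral_def)
  also have "(LBINT z. ?g z) = (LBINT u. ?g (- w + 1 * u))"
    using lborel_integral_real_affine[of 1 ?g "- w"] by simp
  also have "\<dots> = (LBINT u:{0<..}. laplace_density \<mu> \<sigma> (u - w) * \<phi> u)"
    unfolding set_lebesgue_integral_def
    by (intro Bochner_Integration.integral_cong) (auto simp: indicator_def)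
  finally show ?thesis .
qed

text \<open>The law of the process, tested against bounded measurable functions. This class is
  closed under the transition operator, which the induction needs; test functions are not
  preserved by reflection at 0.\<close>
lemma expectation_lindley:
  assumes "lindley_coeffs \<mu> \<sigma> x a b c" and "1 \<le> n"
    and "\<phi> \<in> borel_measurable borel" and "\<And>y. \<bar>\<phi> y\<bar> \<le> K"
  shows "expectation (\<lambda>\<omega>. \<phi> (lindley x Z n \<omega>)) = c n * \<phi> 0 + (LBINT u. lindley_density \<mu> \<sigma> x a b n u * \<phi> u)"
  using assms(2-4)
proof (induction n arbitrary: \<phi> rule: nat_induct_at_least)
  case base
  note [measurable] = base(1)
  interpret lindley_coefficients \<mu> \<sigma> x a b c
    by unfold_locales (use mu sigma x assms(1) in auto)
  have "expectation (\<lambda>\<omega>. \<phi> (lindley x Z 1 \<omega>)) = reflected_step \<mu> \<sigma> \<phi> x"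
    using expectation_lindley_Suc[of \<phi> K 0] base by (simp add: prob_space)
  also have "\<dots> = c 1 * \<phi> 0 + (LBINT u:{0<..}. laplace_density \<mu> \<sigma> (u - x) * \<phi> u)"
    using reflected_step_eq[of \<phi> K x] base x by (simp add: coeffs_1[unfolded One_nat_def] add.commute)
  also have "(LBINT u:{0<..}. laplace_density \<mu> \<sigma> (u - x) * \<phi> u) = (LBINT u. lindley_density \<mu> \<sigma> x a b 1 u * \<phi> u)"
    unfolding set_lebesgue_integral_def
  proof (intro Bochner_Integration.integral_cong refl)
    fix u
    show "indicator {0<..} u *\<^sub>R (laplace_density \<mu> \<sigma> (u - x) * \<phi> u) = lindley_density \<mu> \<sigma> x a b 1 u * \<phi> u"
      using lindley_density_1[of u] lindley_density_nonpos[of 1 u] sigma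
      by (cases "0 < u") (simp_all add: laplace_density_def field_simps)
  qed
  finally show ?case .
next
  case (Suc n \<phi>)
  note [measurable] = Suc.prems(1)
  interpret lindley_coefficients \<mu> \<sigma> x a b c
    by unfold_locales (use mu sigma x assms(1) in auto)
  note n = Suc.hyps
  let ?g = "lindley_density \<mu> \<sigma> x a b n"
  let ?\<psi> = "reflected_step \<mu> \<sigma> \<phi>"
  let ?l = "laplace_density \<mu> \<sigma>"
  let ?\<phi> = "\<lambda>u. indicator {0<..} u * \<phi> u"
  have step: "?\<psi> y = \<phi> 0 * (exp (- \<mu> / \<sigma>) / 2 * exp (- \<bar>0 - y\<bar> / \<sigma>)) + (LBINT u. ?l (u - y) * ?\<phi> u)" if "0 \<le> y" for y
  proof -
    \<comment> \<open>The atom is written as a value of the Laplace kernel at 0, so that it becomes the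
      convolution at $v = 0$ that computes the next atom.\<close>
    have "exp (- (y + \<mu>) / \<sigma>) = exp (- \<mu> / \<sigma>) * exp (- \<bar>0 - y\<bar> / \<sigma>)"
      using that by (simp add: exp_add[symmetric] add_divide_distrib diff_divide_distrib)
    then show ?thesis
      using reflected_step_eq[OF Suc.prems that] by (simp add: set_lebesgue_integral_def mult_ac)
  qed
  define h where "h y u = ?g y * (?l (u - y) * ?\<phi> u)" for y u
  have shift: "integrable lborel (\<lambda>u. ?l (u - y))" "(LBINT u. ?l (u - y)) = 1" for y
    using lborel_integrable_real_affine[OF laplace_integrable, of 1 "- y"]
      lborel_integral_real_affine[of 1 ?l "- y"] laplace_integral by simp_all
  \<comment> \<open>Without the test function the inner integral of the modulus is the density itself, since
    the translated kernel has mass 1; the bound on the test function then dominates \<open>h\<close>.\<close>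
  have "integrable (lborel \<Otimes>\<^sub>M lborel) (\<lambda>(y, u). ?g y * ?l (u - y))"
  proof (rule lborel_pair.Fubini_integrable)
    show "(\<lambda>(y, u). ?g y * ?l (u - y)) \<in> borel_measurable (lborel \<Otimes>\<^sub>M lborel)" by measurable
    have "(\<lambda>y. LBINT u. norm (case (y, u) of (y, u) \<Rightarrow> ?g y * ?l (u - y))) = (\<lambda>y. norm (?g y))"
      using shift laplace_density_nonneg[OF sigma] by (simp add: abs_mult)
    then show "integrable lborel (\<lambda>y. LBINT u. norm (case (y, u) of (y, u) \<Rightarrow> ?g y * ?l (u - y)))"
      using integrable_lindley_density[OF n] by simp
  qed (use shift in simp)
  then have "integrable (lborel \<Otimes>\<^sub>M lborel) (\<lambda>p. K * (case p of (y, u) \<Rightarrow> ?g y * ?l (u - y)))"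
    by (rule integrable_mult_right)
  then have h: "integrable (lborel \<Otimes>\<^sub>M lborel) (case_prod h)"
  proof (rule Bochner_Integration.integrable_bound)
    show "case_prod h \<in> borel_measurable (lborel \<Otimes>\<^sub>M lborel)" unfolding h_def by measurable
    show "AE p in lborel \<Otimes>\<^sub>M lborel. norm (case_prod h p) \<le> norm (K * (case p of (y, u) \<Rightarrow> ?g y * ?l (u - y)))"
    proof (intro AE_I2)
      fix p :: "real \<times> real"
      obtain y u where p: "p = (y, u)" by (cases p)
      have "\<bar>?\<phi> u\<bar> \<le> \<bar>K\<bar>" using Suc.prems(2)[of u] by (auto simp: indicator_def)
      then have "\<bar>?g y * ?l (u - y)\<bar> * \<bar>?\<phi> u\<bar> \<le> \<bar>?g y * ?l (u - y)\<bar> * \<bar>K\<bar>"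
        by (intro mult_left_mono) auto
      then show "norm (case_prod h p) \<le> norm (K * (case p of (y, u) \<Rightarrow> ?g y * ?l (u - y)))"
        by (simp add: p h_def abs_mult mult_ac)
    qed
  qed
  have ge: "integrable lborel (\<lambda>y. ?g y * exp (- \<bar>0 - y\<bar> / \<sigma>))"
    using set_integrable_mult_bounded[of UNIV ?g "\<lambda>y. exp (- \<bar>0 - y\<bar> / \<sigma>)" 1] integrable_lindley_density[OF n] sigma
    by (simp add: set_integrable_def)
  have h1: "integrable lborel (\<lambda>y. LBINT u. h y u)" using h by (rule lborel_pair.integrable_fst)
  have h2: "integrable lborel (\<lambda>u. LBINT y. h y u)" using h by (rule lborel_pair.integrable_snd)
  have l\<phi>: "integrable lborel (\<lambda>u. ?l u * ?\<phi> u)"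
    using Suc.prems(2) abs_ge_zero[of "\<phi> 0"] by (intro laplace_mult_integrable[of _ "\<bar>K\<bar>"]) (auto simp: indicator_def intro: order_trans[OF _ abs_ge_self])
  have "expectation (\<lambda>\<omega>. \<phi> (lindley x Z (Suc n) \<omega>)) = expectation (\<lambda>\<omega>. ?\<psi> (lindley x Z n \<omega>))"
    using Suc.prems by (rule expectation_lindley_Suc)
  also have "\<dots> = c n * ?\<psi> 0 + (LBINT y. ?g y * ?\<psi> y)"
    using reflected_step_bounded[OF Suc.prems] by (intro Suc.IH) measurable
  also have "(LBINT y. ?g y * ?\<psi> y) =
      (LBINT y. \<phi> 0 * (exp (- \<mu> / \<sigma>) / 2) * (?g y * exp (- \<bar>0 - y\<bar> / \<sigma>)) + (LBINT u. h y u))"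
  proof (intro Bochner_Integration.integral_cong refl)
    fix y
    show "?g y * ?\<psi> y = \<phi> 0 * (exp (- \<mu> / \<sigma>) / 2) * (?g y * exp (- \<bar>0 - y\<bar> / \<sigma>)) + (LBINT u. h y u)"
    proof (cases "0 \<le> y")
      case True
      then show ?thesis unfolding step[OF True] h_def by (simp add: distrib_left)
    next
      case False
      then show ?thesis using lindley_density_nonpos[OF n, of y] by (simp add: h_def)
    qed
  qed
  also have "\<dots> = \<phi> 0 * (exp (- \<mu> / \<sigma>) / 2) * (LBINT y. ?g y * exp (- \<bar>0 - y\<bar> / \<sigma>)) + (LBINT y. LBINT u. h y u)"
    using ge h1 by simp
  also have "(LBINT y. LBINT u. h y u) = (LBINT u. LBINT y. h y u)"
    using lborel_pair.Fubini_integral[OF h] by simp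
  also have "?\<psi> 0 = \<phi> 0 * (exp (- \<mu> / \<sigma>) / 2) + (LBINT u. ?l u * ?\<phi> u)"
    using step[of 0] by simp
  finally have E: "expectation (\<lambda>\<omega>. \<phi> (lindley x Z (Suc n) \<omega>)) =
      \<phi> 0 * (exp (- \<mu> / \<sigma>) * (c n + (LBINT y. ?g y * exp (- \<bar>0 - y\<bar> / \<sigma>)))) / 2
      + (c n * (LBINT u. ?l u * ?\<phi> u) + (LBINT u. LBINT y. h y u))"
    by (simp only: algebra_simps times_divide_eq_left times_divide_eq_right add_divide_distrib)
  have "c n * (LBINT u. ?l u * ?\<phi> u) + (LBINT u. LBINT y. h y u) = (LBINT u. c n * (?l u * ?\<phi> u) + (LBINT y. h y u))"
    using l\<phi> h2 by simp
  also have "\<dots> = (LBINT u. lindley_density \<mu> \<sigma> x a b (n + 1) u * \<phi> u)"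
  proof (intro Bochner_Integration.integral_cong refl)
    fix u
    show "c n * (?l u * ?\<phi> u) + (LBINT y. h y u) = lindley_density \<mu> \<sigma> x a b (n + 1) u * \<phi> u"
    proof (cases "0 < u")
      case True
      have "?l (u - y) = exp (- \<bar>u - \<mu> - y\<bar> / \<sigma>) / (2 * \<sigma>)" for y
        by (simp add: laplace_density_def diff_diff_eq add.commute)
      then have "(\<lambda>y. h y u) = (\<lambda>y. (?g y * exp (- \<bar>u - \<mu> - y\<bar> / \<sigma>)) * (\<phi> u / (2 * \<sigma>)))"
        using True by (simp add: fun_eq_iff h_def)
      then have "(LBINT y. h y u) = (LBINT y. ?g y * exp (- \<bar>u - \<mu> - y\<bar> / \<sigma>)) * (\<phi> u / (2 * \<sigma>))"
        by (simp only: integral_mult_left_zero)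
      moreover have "c n * (?l u * ?\<phi> u) = c n * exp (- \<bar>u - \<mu>\<bar> / \<sigma>) * (\<phi> u / (2 * \<sigma>))"
        using True by (simp add: laplace_density_def)
      ultimately have "c n * (?l u * ?\<phi> u) + (LBINT y. h y u) =
          2 * \<sigma> * lindley_density \<mu> \<sigma> x a b (n + 1) u * (\<phi> u / (2 * \<sigma>))"
        by (simp only: lindley_density_Suc[OF n True] distrib_right)
      then show ?thesis using sigma by simp
    next
      case False
      then show ?thesis using lindley_density_nonpos[of "n + 1" u] by (simp add: h_def)
    qed
  qed
  finally show ?case unfolding E c_Suc[OF n, symmetric] by (simp add: mult.commute)
qed

lemma lindley_gf_density:
  assumes "lindley_coeffs \<mu> \<sigma> x a b c" and "1 \<le> n"
  shows "has_gf_density M (lindley x Z n) (f_gf \<mu> \<sigma> x a b c n)"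
proof (rule distributional_deriv_of_cdf)
  interpret lindley_coefficients \<mu> \<sigma> x a b c
    by unfold_locales (use mu sigma x assms(1) in auto)
  fix \<phi> assume \<phi>: "test_function \<phi>"
  obtain K where K: "\<And>y. \<bar>\<phi> y\<bar> \<le> K" using test_function_bounded[OF \<phi>] by blast
  have m[measurable]: "\<phi> \<in> borel_measurable borel"
    by (intro borel_measurable_continuous_onI test_function_continuous \<phi>)
  have "(LBINT u. lindley_density \<mu> \<sigma> x a b n u * \<phi> u) = (LBINT u. \<Sum>i=1..n + 1. f_piece \<mu> \<sigma> x a b n i u * \<phi> u)"
    by (simp only: lindley_density_def sum_distrib_right)
  also have "\<dots> = (\<Sum>i=1..n + 1. regular_gf (f_piece \<mu> \<sigma> x a b n i) \<phi>)"
    unfolding regular_gf_def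
  proof (rule Bochner_Integration.integral_sum)
    fix i assume "i \<in> {1..n + 1}"
    then show "integrable lborel (\<lambda>u. f_piece \<mu> \<sigma> x a b n i u * \<phi> u)"
      using set_integrable_mult_bounded[of UNIV "f_piece \<mu> \<sigma> x a b n i" \<phi> K] integrable_f_piece[OF assms(2)] K
      by (simp add: set_integrable_def)
  qed
  moreover have "f_gf \<mu> \<sigma> x a b c n \<phi> = c n * \<phi> 0 + (\<Sum>i=1..n + 1. regular_gf (f_piece \<mu> \<sigma> x a b n i) \<phi>)"
    unfolding f_gf_def by (subst sum.atLeast_Suc_atMost) (simp_all add: dirac_def)
  ultimately show "f_gf \<mu> \<sigma> x a b c n \<phi> = expectation (\<lambda>\<omega>. \<phi> (lindley x Z n \<omega>))"
    using expectation_lindley[OF assms m K] by simp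
qed (rule measurable_lindley)

lemma lindley_0_gf_density: "has_gf_density M (lindley x Z 0) (dirac x)"
  by (rule distributional_deriv_of_cdf) (auto simp: dirac_def prob_space)

end

theorem theorem3p4:
  fixes M :: "'a measure" and Z :: "nat \<Rightarrow> 'a \<Rightarrow> real" and \<mu> \<sigma> x :: real
  assumes "prob_space M"
    and "\<mu> \<ge> 0" and "\<sigma> > 0" and "x > 0"
    and "prob_space.indep_vars M (\<lambda>_. borel) Z {1..}"
    and "\<And>k. k \<ge> 1 \<Longrightarrow> distributed M lborel (Z k) (\<lambda>z. ennreal (laplace_density \<mu> \<sigma> z))"
  shows "(\<forall>n\<ge>1. (\<Union>i\<in>{0..n + 1}. I_set \<mu> x n i) = {0..}) \<and>
    has_gf_density M (lindley x Z 0) (dirac x) \<and>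
    (\<exists>a b c. lindley_coeffs \<mu> \<sigma> x a b c) \<and>
    (\<forall>a b c. lindley_coeffs \<mu> \<sigma> x a b c \<longrightarrow>
       (\<forall>n\<ge>1. has_gf_density M (lindley x Z n) (f_gf \<mu> \<sigma> x a b c n)))"
proof -
  interpret laplace_lindley M Z \<mu> \<sigma> x
    using assms by (simp add: laplace_lindley_def laplace_lindley_axioms_def)
  show ?thesis
    using I_set_cover[OF mu x] lindley_0_gf_density lindley_coeffs_exist lindley_gf_density by blast
qed

end
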